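(* Let $n \ge 1$ be an integer, let $1 < p < n+1$, and let $q$ be given by $\frac{1}{q} = \frac{n+1}{np} - \frac{1}{n}$. Let $$f(x,y) = c_0\,[(1+y)^2 + |x|^2]^{-\frac{n+1-p}{2(p-1)}}, \qquad (x,y) \in \mathbf{R}^{n+1}_+,$$ where $c_0 > 0$ is the constant determined by $\int_{\mathbf{R}^n} |f(x,0)|^q\,dx = 1$. Define $$\mathcal{J}(\omega) = \int_{\mathbf{R}^{n+1}_+} |\nabla \omega(x,y)|^p\,dx\,dy$$ for $\omega$ in the admissible set $$\mathcal{A} = \Big\{ \omega \in W^{1,p}(\mathbf{R}^{n+1}_+) : \omega \text{ is a function of } (1+y)^2 + |x|^2, \text{ and } \omega(x,0) = c_0 (1+|x|^2)^{-\frac{n+1-p}{2(p-1)}} \Big\}.$$ Then $$\mathcal{J}(f) = \min_{\omega \in \mathcal{A}} \mathcal{J}(\omega),$$ i.e. the infimum of $\mathcal{J}$ on $\mathcal{A}$ is attained at $f$.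
   Context: $\mathbf{R}^{n+1}_+ = \{(x,y) : x \in \mathbf{R}^n,\ y > 0\}$, and $\omega(x,0)$ denotes the trace of $\omega$ on $\mathbf{R}^n$. "$\omega$ is a function of $(1+y)^2+|x|^2$" means $\omega(x,y) = \Phi((1+y)^2+|x|^2)$ for some function $\Phi$ of one real variable. Here $W^{1,p}(\mathbf{R}^{n+1}_+)$ denotes the homogeneous Sobolev space: the real-valued functions $u \in L^{(n+1)p/(n+1-p)}(\mathbf{R}^{n+1}_+)$ whose weak gradient belongs to $L^p(\mathbf{R}^{n+1}_+)$. *)

theory Defs
  imports "HOL-Analysis.Analysis"
begin

definition Lp_space :: "'a::euclidean_space set \<Rightarrow> real \<Rightarrow> ('a \<Rightarrow> 'b::euclidean_space) set" where
  "Lp_space S r = {u \<in> borel_measurable (lebesgue_on S).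
     integrable (lebesgue_on S) (\<lambda>x. norm (u x) powr r)}"

definition Lp_norm :: "'a::euclidean_space set \<Rightarrow> real \<Rightarrow> ('a \<Rightarrow> 'b::euclidean_space) \<Rightarrow> real" where
  "Lp_norm S r u = (LINT x|lebesgue_on S. norm (u x) powr r) powr (1 / r)"

text \<open>Membership of the differences is required explicitly, because the Bochner integral of a
  non-integrable function is \<open>0\<close>.\<close>

definition Lp_tendsto ::
  "'a::euclidean_space set \<Rightarrow> real \<Rightarrow> (nat \<Rightarrow> 'a \<Rightarrow> 'b::euclidean_space) \<Rightarrow> ('a \<Rightarrow> 'b) \<Rightarrow> bool" where
  "Lp_tendsto S r U u \<longleftrightarrow>
     (\<forall>k. (\<lambda>x. U k x - u x) \<in> Lp_space S r) \<and>
     (\<lambda>k. Lp_norm S r (\<lambda>x. U k x - u x)) \<longlonglongrightarrow> 0"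

primrec Ck :: "nat \<Rightarrow> ('a::euclidean_space \<Rightarrow> real) \<Rightarrow> bool" where
  "Ck 0 \<phi> \<longleftrightarrow> continuous_on UNIV \<phi>"
| "Ck (Suc k) \<phi> \<longleftrightarrow> (\<forall>x. \<phi> differentiable (at x)) \<and>
     (\<forall>i\<in>Basis. Ck k (\<lambda>x. frechet_derivative \<phi> (at x) i))"

definition test_functions :: "'a::euclidean_space set \<Rightarrow> ('a \<Rightarrow> real) set" where
  "test_functions S = {\<phi>. (\<forall>k. Ck k \<phi>) \<and>
     compact (closure {x. \<phi> x \<noteq> 0}) \<and> closure {x. \<phi> x \<noteq> 0} \<subseteq> S}"

definition locally_integrable :: "'a::euclidean_space set \<Rightarrow> ('a \<Rightarrow> 'b::euclidean_space) \<Rightarrow> bool" where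
  "locally_integrable S u \<longleftrightarrow> (\<forall>K. compact K \<and> K \<subseteq> S \<longrightarrow> u absolutely_integrable_on K)"

definition is_weak_gradient :: "'a::euclidean_space set \<Rightarrow> ('a \<Rightarrow> real) \<Rightarrow> ('a \<Rightarrow> 'a) \<Rightarrow> bool" where
  "is_weak_gradient S u g \<longleftrightarrow> locally_integrable S u \<and> locally_integrable S g \<and>
     (\<forall>\<phi>\<in>test_functions S. \<forall>i\<in>Basis.
        (LINT x|lebesgue_on S. u x * frechet_derivative \<phi> (at x) i) =
        - (LINT x|lebesgue_on S. (g x \<bullet> i) * \<phi> x))"

text \<open>On an open set weak gradients are unique up to null sets, so the choice below is immaterial
  under integrals.\<close>

definition weak_gradient :: "'a::euclidean_space set \<Rightarrow> ('a \<Rightarrow> real) \<Rightarrow> 'a \<Rightarrow> 'a" where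
  "weak_gradient S u = (SOME g. is_weak_gradient S u g)"

text \<open>The homogeneous Sobolev space; for \<open>1 \<le> p < DIM('a)\<close> the exponent in the first condition is
  the critical Sobolev exponent.  Elements are functions, not classes modulo null sets.\<close>

definition hom_sobolev :: "'a::euclidean_space set \<Rightarrow> real \<Rightarrow> ('a \<Rightarrow> real) set" where
  "hom_sobolev S p =
     {u \<in> Lp_space S (real DIM('a) * p / (real DIM('a) - p)).
        \<exists>g \<in> Lp_space S p. is_weak_gradient S u g}"

definition halfspace :: "((real^'n) \<times> real) set" where
  "halfspace = {(x, y). y > 0}"

text \<open>The trace operator is the continuous extension, from the homogeneous Sobolev space into
  \<open>L\<^sup>s(\<real>\<^sup>n)\<close> with \<open>s = n p / (n + 1 - p)\<close>, of the restriction \<open>u \<mapsto> u(\<cdot>, 0)\<close> defined on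
  Sobolev functions that are continuous up to the boundary.  The predicate says that \<open>t\<close> is a
  representative of the trace of \<open>u\<close>.\<close>

definition has_trace :: "real \<Rightarrow> ((real^'n) \<times> real \<Rightarrow> real) \<Rightarrow> (real^'n \<Rightarrow> real) \<Rightarrow> bool" where
  "has_trace p u t \<longleftrightarrow>
     (\<exists>U. (\<forall>k. U k \<in> hom_sobolev halfspace p \<and> continuous_on (closure halfspace) (U k)) \<and>
        Lp_tendsto halfspace (real (CARD('n) + 1) * p / (real (CARD('n) + 1) - p)) U u \<and>
        Lp_tendsto halfspace p (\<lambda>k. weak_gradient halfspace (U k)) (weak_gradient halfspace u) \<and>
        Lp_tendsto UNIV (real CARD('n) * p / (real (CARD('n) + 1) - p)) (\<lambda>k x. U k (x, 0)) t)"

definition energy :: "real \<Rightarrow> ((real^'n) \<times> real \<Rightarrow> real) \<Rightarrow> real" where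
  "energy p \<omega> = (LINT z|lebesgue_on halfspace. norm (weak_gradient halfspace \<omega> z) powr p)"

text \<open>Since membership in the Sobolev space only matters up to null sets, so does the requirement
  of being a function of \<open>(1 + y)\<^sup>2 + |x|\<^sup>2\<close>; no regularity of \<open>\<Phi>\<close> is assumed.\<close>

definition admissible :: "real \<Rightarrow> real \<Rightarrow> ((real^'n) \<times> real \<Rightarrow> real) set" where
  "admissible p c0 =
     {\<omega> \<in> hom_sobolev halfspace p.
        (\<exists>\<Phi> :: real \<Rightarrow> real. AE (x, y) in lebesgue_on halfspace.
            \<omega> (x, y) = \<Phi> ((1 + y)\<^sup>2 + (norm x)\<^sup>2)) \<and>
        has_trace p \<omega> (\<lambda>x. c0 * (1 + (norm x)\<^sup>2)
          powr (- ((real CARD('n) + 1 - p) / (2 * (p - 1)))))}"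

end

theory Submission
  imports Defs
begin

text \<open>
  The function \<open>f\<close> is \<open>p\<close>-harmonic: \<open>\<bar>\<nabla>f\<bar>\<^sup>p\<^sup>-\<^sup>2 \<nabla>f\<close> is a constant multiple of the divergence-free field
  \<open>G(z) = \<bar>z + e\<bar>\<^sup>-\<^sup>N (z + e)\<close> with \<open>N = n + 1\<close> and \<open>e\<close> the upward unit vector.  Hence the flux
  \<open>\<integral> \<nabla>\<omega> \<bullet> G\<close> depends only on the trace of \<open>\<omega>\<close>, and Young's inequality gives
  \<open>J(f) = \<integral> \<bar>\<nabla>f\<bar>\<^sup>p\<^sup>-\<^sup>2 \<nabla>f \<bullet> \<nabla>\<omega> \<le> (1 - 1/p) J(f) + J(\<omega>)/p\<close>, that is \<open>J(f) \<le> J(\<omega>)\<close>.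
  The flux identity is obtained by testing the weak gradient of a Sobolev function that is continuous
  up to the boundary against compactly supported smooth truncations of \<open>G\<close>, passing to the limit
  along the approximations that define the trace, and finally removing the truncation.
\<close>

section \<open>Smooth functions of one variable\<close>

text \<open>With s = |z + e|^2, the field \<open>k s *\<^sub>R (z + e)\<close> has divergence N k(s)
  + 2 s k'(s), which vanishes for k(s) = s powr (- N / 2); this is the origin of \<open>G\<close>.
  The field \<open>G\<close> cannot be inserted directly: test functions have compact support in the
  open half-space, and the trace is known only as a limit in L^q, q = np / (N - p), of boundary
  values. Truncating in s gives factors that lie in every L^r, so all three terms of the integration
  by parts pass to the limit by Hoelder's inequality. Two exponent facts then allow the truncation
  to be removed: p < N puts \<open>G\<close> into the dual of L^p, and the divergence created by the
  truncation is bounded by a multiple of |z + e|^(-N), a function in the dual of L^P, P = Np / (N -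
  p). The boundary integrals are compared at each fixed truncation, where they coincide for
  \<open>f\<close> and its competitor. Since test functions carry derivatives of every order, the
  cutoffs are built from exp(-1/x) in classes of functions stable under differentiation.\<close>

definition smooth_real :: "(real \<Rightarrow> real) \<Rightarrow> bool" where
  "smooth_real h \<longleftrightarrow> (\<exists>H. H 0 = h \<and> (\<forall>k x. (H k has_real_derivative H (Suc k) x) (at x)))"

text \<open>Iterating a choice of derivative inside \<open>F\<close> produces the whole sequence
  \<open>H\<close>, so smoothness reduces to exhibiting a family closed under
  differentiation.\<close>

lemma smooth_realI:
  assumes "h \<in> F" and F: "\<And>\<phi>. \<phi> \<in> F \<Longrightarrow> \<exists>\<phi>'\<in>F. \<forall>x. (\<phi> has_real_derivative \<phi>' x) (at x)"
  shows "smooth_real h"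
proof -
  obtain d where d: "\<And>\<phi>. \<phi> \<in> F \<Longrightarrow> d \<phi> \<in> F \<and> (\<forall>x. (\<phi> has_real_derivative d \<phi> x) (at x))"
    using F by metis
  have "(d ^^ k) h \<in> F" for k
    using \<open>h \<in> F\<close> d by (induction k) auto
  then show ?thesis
    unfolding smooth_real_def using d by (intro exI[of _ "\<lambda>k. (d ^^ k) h"]) auto
qed

lemma smooth_real_derivE:
  assumes "smooth_real h"
  obtains h' where "smooth_real h'" "\<And>x. (h has_real_derivative h' x) (at x)"
proof -
  obtain H where H: "H 0 = h" "\<And>k x. (H k has_real_derivative H (Suc k) x) (at x)"
    using assms unfolding smooth_real_def by blast
  have "smooth_real (H 1)"
    unfolding smooth_real_def using H(2) by (intro exI[of _ "\<lambda>k. H (Suc k)"]) auto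
  with H(1) H(2)[of 0] show thesis
    by (intro that[of "H 1"]) auto
qed

lemma smooth_real_antiderivative:
  assumes "smooth_real h'" "\<And>x. (h has_real_derivative h' x) (at x)"
  shows "smooth_real h"
proof (rule smooth_realI[where F = "insert h {g. smooth_real g}"])
  fix \<phi> assume "\<phi> \<in> insert h {g. smooth_real g}"
  then show "\<exists>\<phi>'\<in>insert h {g. smooth_real g}. \<forall>x. (\<phi> has_real_derivative \<phi>' x) (at x)"
    using assms smooth_real_derivE by (metis insertCI insertE mem_Collect_eq)
qed simp

text \<open>Differentiating a product or a composite leaves the natural family of such functions but
  stays in its linear span. With spans, closure under differentiation has to be checked only on the
  generators.\<close>

inductive_set fspan :: "(real \<Rightarrow> real) set \<Rightarrow> (real \<Rightarrow> real) set" for B where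
  base: "f \<in> B \<Longrightarrow> f \<in> fspan B"
| scale: "f \<in> fspan B \<Longrightarrow> (\<lambda>x. c * f x) \<in> fspan B"
| add: "f \<in> fspan B \<Longrightarrow> g \<in> fspan B \<Longrightarrow> (\<lambda>x. f x + g x) \<in> fspan B"


lemma smooth_real_fspan:
  assumes B: "\<And>b. b \<in> B \<Longrightarrow> \<exists>b'\<in>fspan B. \<forall>x. (b has_real_derivative b' x) (at x)"
    and f: "f \<in> fspan B"
  shows "smooth_real f"
proof (rule smooth_realI[OF f])
  fix \<phi> assume "\<phi> \<in> fspan B"
  then show "\<exists>\<phi>'\<in>fspan B. \<forall>x. (\<phi> has_real_derivative \<phi>' x) (at x)"
  proof induction
    case (scale f c)
    then obtain f' where "f' \<in> fspan B" "\<forall>x. (f has_real_derivative f' x) (at x)"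
      by blast
    then show ?case
      by (intro bexI[of _ "\<lambda>x. c * f' x"] fspan.scale) (auto intro: DERIV_cmult)
  next
    case (add f g)
    then obtain f' g' where "f' \<in> fspan B" "\<forall>x. (f has_real_derivative f' x) (at x)"
      "g' \<in> fspan B" "\<forall>x. (g has_real_derivative g' x) (at x)"
      by blast
    then show ?case
      by (intro bexI[of _ "\<lambda>x. f' x + g' x"] fspan.add) (auto intro: DERIV_add)
  qed (use B in auto)
qed

lemma smooth_real_const: "smooth_real (\<lambda>x. c)"
  by (rule smooth_realI[where F = "range (\<lambda>c x. c)"]) (auto intro: DERIV_const)

lemma smooth_real_mult:
  assumes "smooth_real f" "smooth_real g"
  shows "smooth_real (\<lambda>x. f x * g x)"
proof -
  let ?B = "{\<lambda>x. f x * g x |f g. smooth_real f \<and> smooth_real g}"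
  show ?thesis
  proof (rule smooth_real_fspan[where B = ?B])
    fix b assume "b \<in> ?B"
    then obtain f g where b: "b = (\<lambda>x. f x * g x)" and fg: "smooth_real f" "smooth_real g"
      by blast
    obtain f' g' where f': "smooth_real f'" "\<And>x. (f has_real_derivative f' x) (at x)"
      and g': "smooth_real g'" "\<And>x. (g has_real_derivative g' x) (at x)"
      using fg smooth_real_derivE by metis
    have "(\<lambda>x. f' x * g x + f x * g' x) \<in> fspan ?B"
      using fg f'(1) g'(1) by (intro fspan.add fspan.base) blast+
    moreover have "(b has_real_derivative f' x * g x + f x * g' x) (at x)" for x
      unfolding b using f'(2) g'(2) by (auto intro!: derivative_eq_intros)
    ultimately show "\<exists>b'\<in>fspan ?B. \<forall>x. (b has_real_derivative b' x) (at x)"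
      by (intro bexI[of _ "\<lambda>x. f' x * g x + f x * g' x"]) auto
  qed (use assms in \<open>blast intro: fspan.base\<close>)
qed

lemma smooth_real_affine:
  assumes "smooth_real f"
  shows "smooth_real (\<lambda>x. f (a * x + b))"
proof (rule smooth_real_fspan[where B = "{\<lambda>x. f (a * x + b) |f. smooth_real f}"])
  fix h assume "h \<in> {\<lambda>x. f (a * x + b) |f. smooth_real f}"
  then obtain f where f: "smooth_real f" and h: "h = (\<lambda>x. f (a * x + b))" by blast
  obtain f' where f': "smooth_real f'" "\<And>x. (f has_real_derivative f' x) (at x)"
    using f smooth_real_derivE by metis
  have "(h has_real_derivative a * f' (a * x + b)) (at x)" for x
  proof -
    have "((\<lambda>x. a * x + b) has_real_derivative a) (at x)"
      by (auto intro!: derivative_eq_intros)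
    from DERIV_chain2[OF f'(2) this] show ?thesis
      unfolding h by (simp add: mult.commute)
  qed
  moreover have "(\<lambda>x. a * f' (a * x + b)) \<in> fspan {\<lambda>x. f (a * x + b) |f. smooth_real f}"
    using f'(1) by (intro fspan.scale fspan.base) blast
  ultimately show "\<exists>b'\<in>fspan {\<lambda>x. f (a * x + b) |f. smooth_real f}.
      \<forall>x. (h has_real_derivative b' x) (at x)"
    by (intro bexI[of _ "\<lambda>x. a * f' (a * x + b)"]) auto
qed (use assms in \<open>blast intro: fspan.base\<close>)

text \<open>For \<open>n = 0\<close> this is the classical smooth function exp(-1/x) extended by 0.
  The denominators \<open>x ^ n\<close> are included because differentiation produces them; the span
  of all \<open>flat n\<close> is then closed under derivatives.\<close>

definition flat :: "nat \<Rightarrow> real \<Rightarrow> real" where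
  "flat n x = (if x \<le> 0 then 0 else exp (- (1 / x)) / x ^ n)"

lemma flat_0_deriv_limit: "((\<lambda>x. flat n x / x) \<longlongrightarrow> 0) (at 0)"
proof -
  have "((\<lambda>x. flat n x / x) \<longlongrightarrow> 0) (at_left 0)"
    by (rule tendsto_eventually) (auto simp: flat_def eventually_at_filter)
  \<comment> \<open>With t = 1 / x the right-hand quotient is t^(n+1) / exp t, where the exponential
    wins.\<close>
  moreover have "((\<lambda>x::real. inverse x ^ Suc n / exp (inverse x)) \<longlongrightarrow> 0) (at_right 0)"
    using filterlim_compose[OF tendsto_power_div_exp_0 filterlim_inverse_at_top_right] .
  then have "((\<lambda>x. flat n x / x) \<longlongrightarrow> 0) (at_right 0)"
    by (rule Lim_transform_eventually)
      (auto simp: flat_def eventually_at_filter exp_minus field_simps)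
  ultimately show ?thesis
    by (simp add: filterlim_at_split)
qed

lemma flat_has_derivative:
  "(flat n has_real_derivative flat (n + 2) x - real n * flat (n + 1) x) (at x)"
proof (cases x "0::real" rule: linorder_cases)
  case equal
  then show ?thesis
    using flat_0_deriv_limit[of n] by (simp add: has_field_derivative_iff flat_def)
next
  case less
  have "((\<lambda>x. 0) has_real_derivative 0) (at x)" by simp
  then have "(flat n has_real_derivative 0) (at x)"
    by (rule has_field_derivative_transform_within_open[of _ _ _ "{..<0}"])
      (use less in \<open>auto simp: flat_def\<close>)
  then show ?thesis using less by (simp add: flat_def)
next
  case greater
  have "((\<lambda>x. exp (- (1 / x)) / x ^ n) has_real_derivative
      exp (- (1 / x)) / x ^ (n + 2) - real n * (exp (- (1 / x)) / x ^ (n + 1))) (at x)"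
  proof -
    have "((\<lambda>x. exp (- (1 / x)) / x ^ n) has_real_derivative
        (exp (- (1 / x)) * (1 / x\<^sup>2) * x ^ n - exp (- (1 / x)) * (real n * x ^ (n - 1))) /
          (x ^ n * x ^ n)) (at x)"
      using greater by (auto intro!: derivative_eq_intros simp: power2_eq_square)
    \<comment> \<open>The case \<open>n = 0\<close> is split off because the power rule leaves the
      truncated exponent \<open>n - 1\<close>.\<close>
    then show ?thesis
      by (rule DERIV_cong)
        (use greater in \<open>cases n; simp add: field_simps power2_eq_square\<close>)
  qed
  then have "(flat n has_real_derivative
      exp (- (1 / x)) / x ^ (n + 2) - real n * (exp (- (1 / x)) / x ^ (n + 1))) (at x)"
    by (rule has_field_derivative_transform_within_open[of _ _ _ "{0<..}"])
      (use greater in \<open>auto simp: flat_def\<close>)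
  then show ?thesis using greater by (simp add: flat_def)
qed

lemma smooth_flat: "smooth_real (flat n)"
proof (rule smooth_real_fspan[where B = "range flat"])
  fix b assume "b \<in> range flat"
  then obtain n where b: "b = flat n" by blast
  have "(\<lambda>x. flat (n + 2) x + (- real n) * flat (n + 1) x) \<in> fspan (range flat)"
    by (intro fspan.add fspan.scale) (auto intro: fspan.base)
  then show "\<exists>b'\<in>fspan (range flat). \<forall>x. (b has_real_derivative b' x) (at x)"
    using flat_has_derivative[of n] b by fastforce
qed (auto intro: fspan.base)

lemma smooth_real_continuous: "smooth_real h \<Longrightarrow> continuous_on S h"
  by (metis smooth_real_derivE DERIV_isCont continuous_at_imp_continuous_on)

text \<open>The step is the normalised antiderivative of the bump
  \<open>flat 0 x * flat 0 (1 - x)\<close>. Its derivative is kept as a separate witness: rescaled,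
  it is a nonnegative kernel of mass 1 that later concentrates on the boundary.\<close>

lemma smooth_step_exists:
  "\<exists>s s'. smooth_real s \<and> smooth_real s' \<and> (\<forall>x. (s has_real_derivative s' x) (at x)) \<and>
     (\<forall>x\<le>0. s x = 0) \<and> (\<forall>x\<ge>1. s x = 1) \<and> (\<forall>x. 0 \<le> s' x) \<and> (\<forall>x. x \<le> 0 \<or> 1 \<le> x \<longrightarrow> s' x = 0)"
proof -
  define b where "b x = flat 0 x * flat 0 (1 - x)" for x
  have "smooth_real (\<lambda>x. flat 0 (1 - x))"
    using smooth_real_affine[OF smooth_flat, of 0 "- 1" 1] by simp
  then have sb: "smooth_real b"
    unfolding b_def using smooth_real_mult[OF smooth_flat[of 0], of "\<lambda>x. flat 0 (1 - x)"]
    by simp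
  have b0: "b x = 0" if "x \<le> 0 \<or> 1 \<le> x" for x using that by (auto simp: b_def flat_def)
  have bpos: "b x > 0" if "0 < x" "x < 1" for x using that by (auto simp: b_def flat_def)
  have bnn: "b x \<ge> 0" for x by (auto simp: b_def flat_def)
  have bint: "b integrable_on {u..v}" for u v
    by (rule integrable_continuous_real[OF smooth_real_continuous[OF sb]])
  \<comment> \<open>The integral starts at -1 rather than 0, so that 0 is an interior point of the
    interval and the two-sided derivative is available there.\<close>
  define S where "S x = integral {-1..x} b" for x
  have S0: "S x = 0" if "x \<le> 0" for x
  proof -
    have "integral {-1..x} b = integral {-1..x} (\<lambda>_. 0)"
      by (rule integral_cong) (use b0 that in auto)
    then show ?thesis by (simp add: S_def)
  qed
  have D: "(S has_real_derivative b x) (at x)" for x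
  proof (cases "x < 0")
    case True
    have "((\<lambda>x. 0) has_real_derivative 0) (at x)" by simp
    then have "(S has_real_derivative 0) (at x)"
      by (rule has_field_derivative_transform_within_open[of _ _ _ "{..<0}"])
        (use True S0 in auto)
    then show ?thesis using b0 True by simp
  next
    case False
    have "((\<lambda>u. integral {-1..u} b) has_real_derivative b x) (at x within {-1..x+1})"
      by (rule integral_has_real_derivative) (use False smooth_real_continuous[OF sb] in auto)
    then show ?thesis unfolding S_def using False by (simp add: at_within_Icc_at)
  qed
  define c where "c = S 1"
  have S1: "S x = c" if "x \<ge> 1" for x
  proof -
    have "integral {-1..1} b + integral {1..x} b = integral {-1..x} b"
      by (rule Henstock_Kurzweil_Integration.integral_combine) (use that bint in auto)
    moreover have "integral {1..x} b = integral {1..x} (\<lambda>_. 0)"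
      by (rule integral_cong) (use b0 in auto)
    ultimately show ?thesis by (simp add: S_def c_def)
  qed
  have "c > 0"
    unfolding c_def using DERIV_pos_imp_increasing_open[of 0 1 S] D S0[of 0] bpos
    by (metis DERIV_isCont continuous_at_imp_continuous_on less_eq_real_def less_irrefl zero_less_one)
  have sb': "smooth_real (\<lambda>x. b x / c)"
    using smooth_real_mult[OF smooth_real_const[of "1/c"] sb] by simp
  have D': "((\<lambda>x. S x / c) has_real_derivative b x / c) (at x)" for x
    using D by (rule DERIV_cdivide)
  show ?thesis
    by (intro exI[of _ "\<lambda>x. S x / c"] exI[of _ "\<lambda>x. b x / c"])
      (use sb' D' smooth_real_antiderivative[OF sb' D'] S0 S1 b0 bnn \<open>c > 0\<close> in auto)
qed


text \<open>The power is smooth only for positive arguments, and the cutoff vanishes below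
  \<open>d\<close>. Letting the exponent vary makes the family closed under differentiation: each
  derivative brings in \<open>b - 1\<close>, and \<open>\<sigma>'\<close> vanishes below
  \<open>d\<close> again.\<close>

lemma smooth_real_cutoff_powr:
  assumes "smooth_real \<sigma>" "\<And>s. s < d \<Longrightarrow> \<sigma> s = 0" "d > 0"
  shows "smooth_real (\<lambda>s. \<sigma> s * s powr b)"
proof -
  let ?B = "{\<lambda>s. \<sigma> s * s powr b |\<sigma> b. smooth_real \<sigma> \<and> (\<forall>s<d. \<sigma> s = 0)}"
  show ?thesis
  proof (rule smooth_real_fspan[where B = ?B])
    fix h assume "h \<in> ?B"
    then obtain \<sigma> b where h: "h = (\<lambda>s. \<sigma> s * s powr b)" and
      \<sigma>: "smooth_real \<sigma>" "\<And>s. s < d \<Longrightarrow> \<sigma> s = 0" by blast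
    obtain \<sigma>' where \<sigma>': "smooth_real \<sigma>'" "\<And>x. (\<sigma> has_real_derivative \<sigma>' x) (at x)"
      using \<sigma>(1) smooth_real_derivE by metis
    have \<sigma>'0: "\<sigma>' s = 0" if "s < d" for s
    proof -
      have "((\<lambda>x. 0) has_real_derivative 0) (at s)" by simp
      then have "(\<sigma> has_real_derivative 0) (at s)"
        by (rule has_field_derivative_transform_within_open[of _ _ _ "{..<d}"])
          (use that \<sigma>(2) in auto)
      then show ?thesis using \<sigma>'(2) DERIV_unique by blast
    qed
    have "(h has_real_derivative \<sigma>' s * s powr b + b * (\<sigma> s * s powr (b - 1))) (at s)" for s
    proof (cases "s < d")
      case True
      have "((\<lambda>x. 0) has_real_derivative 0) (at s)" by simp
      then have "(h has_real_derivative 0) (at s)"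
        by (rule has_field_derivative_transform_within_open[of _ _ _ "{..<d}"])
          (use True \<sigma>(2) in \<open>auto simp: h\<close>)
      then show ?thesis using True \<sigma>(2) \<sigma>'0 by simp
    next
      case False
      with \<open>d > 0\<close> have "s > 0" by simp
      then show ?thesis
        unfolding h using \<sigma>'(2)[of s]
        by (auto intro!: derivative_eq_intros simp: field_simps)
    qed
    moreover have "(\<lambda>s. \<sigma>' s * s powr b + b * (\<sigma> s * s powr (b - 1))) \<in> fspan ?B"
      using \<sigma> \<sigma>'(1) \<sigma>'0 by (intro fspan.add fspan.scale fspan.base) blast+
    ultimately show "\<exists>b'\<in>fspan ?B. \<forall>x. (h has_real_derivative b' x) (at x)"
      by (intro bexI[of _ "\<lambda>s. \<sigma>' s * s powr b + b * (\<sigma> s * s powr (b - 1))"]) auto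
  qed (use assms in \<open>blast intro: fspan.base\<close>)
qed

section \<open>Test functions and the fundamental lemma of the calculus of variations\<close>

text \<open>A class generated by the operations from which the test functions below are built. By
  induction on its generation it contains the directional derivatives of its members, which yields
  \<open>Ck k\<close> for every \<open>k\<close> without computing higher derivatives.\<close>

inductive_set smooth_fun :: "('a::euclidean_space \<Rightarrow> real) set" where
  const: "(\<lambda>x. c) \<in> smooth_fun"
| inner: "(\<lambda>x. x \<bullet> a) \<in> smooth_fun"
| add: "\<phi> \<in> smooth_fun \<Longrightarrow> \<psi> \<in> smooth_fun \<Longrightarrow> (\<lambda>x. \<phi> x + \<psi> x) \<in> smooth_fun"
| mult: "\<phi> \<in> smooth_fun \<Longrightarrow> \<psi> \<in> smooth_fun \<Longrightarrow> (\<lambda>x. \<phi> x * \<psi> x) \<in> smooth_fun"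
| comp: "smooth_real h \<Longrightarrow> \<phi> \<in> smooth_fun \<Longrightarrow> (\<lambda>x. h (\<phi> x)) \<in> smooth_fun"

lemma smooth_fun_derivE:
  assumes "\<phi> \<in> smooth_fun"
  obtains D where "\<And>x. (\<phi> has_derivative D x) (at x)" "\<And>v. (\<lambda>x. D x v) \<in> smooth_fun"
proof -
  have "\<exists>D. (\<forall>x. (\<phi> has_derivative D x) (at x)) \<and> (\<forall>v. (\<lambda>x. D x v) \<in> smooth_fun)"
    using assms
  proof induction
    case (const c)
    show ?case
      by (intro exI[of _ "\<lambda>x v. 0"]) (auto intro: smooth_fun.const)
  next
    case (inner a)
    show ?case
      by (intro exI[of _ "\<lambda>x v. v \<bullet> a"])
        (auto intro!: smooth_fun.const derivative_eq_intros)
  next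
    case (add \<phi> \<psi>)
    then obtain D E where "\<forall>x. (\<phi> has_derivative D x) (at x)" "\<forall>v. (\<lambda>x. D x v) \<in> smooth_fun"
      "\<forall>x. (\<psi> has_derivative E x) (at x)" "\<forall>v. (\<lambda>x. E x v) \<in> smooth_fun"
      by blast
    then show ?case
      by (intro exI[of _ "\<lambda>x v. D x v + E x v"])
        (auto intro!: smooth_fun.add derivative_eq_intros)
  next
    case (mult \<phi> \<psi>)
    then obtain D E where "\<forall>x. (\<phi> has_derivative D x) (at x)" "\<forall>v. (\<lambda>x. D x v) \<in> smooth_fun"
      "\<forall>x. (\<psi> has_derivative E x) (at x)" "\<forall>v. (\<lambda>x. E x v) \<in> smooth_fun"
      by blast
    then show ?case
      using mult.hyps
      by (intro exI[of _ "\<lambda>x v. \<phi> x * E x v + D x v * \<psi> x"])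
        (auto intro!: smooth_fun.add smooth_fun.mult has_derivative_mult)
  next
    case (comp h \<phi>)
    then obtain D where D: "\<forall>x. (\<phi> has_derivative D x) (at x)" "\<forall>v. (\<lambda>x. D x v) \<in> smooth_fun"
      by blast
    obtain h' where h': "smooth_real h'" "\<And>x. (h has_real_derivative h' x) (at x)"
      using comp.hyps(1) smooth_real_derivE by metis
    have "((\<lambda>x. h (\<phi> x)) has_derivative (\<lambda>v. h' (\<phi> x) * D x v)) (at x)" for x
      using has_derivative_compose[of \<phi> "D x" x UNIV h "\<lambda>v. h' (\<phi> x) * v"] D(1) h'(2)[of "\<phi> x"]
      by (simp add: has_field_derivative_def)
    moreover have "(\<lambda>x. h' (\<phi> x) * D x v) \<in> smooth_fun" for v
      using smooth_fun.mult[OF smooth_fun.comp[OF h'(1) comp.hyps(2)] D(2)[rule_format, of v]] .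
    ultimately show ?case
      by (intro exI[of _ "\<lambda>x v. h' (\<phi> x) * D x v"]) simp
  qed
  then obtain D where "\<forall>x. (\<phi> has_derivative D x) (at x)" "\<forall>v. (\<lambda>x. D x v) \<in> smooth_fun"
    by (elim exE conjE)
  then show thesis
    by (intro that[of D]) simp_all
qed

lemma smooth_fun_continuous:
  assumes "\<phi> \<in> smooth_fun"
  shows "continuous_on S \<phi>"
proof (rule smooth_fun_derivE[OF assms])
  fix D assume "\<And>x. (\<phi> has_derivative D x) (at x)"
  then show ?thesis
    by (intro continuous_at_imp_continuous_on ballI) (rule has_derivative_continuous)
qed

lemma smooth_fun_Ck: "\<phi> \<in> smooth_fun \<Longrightarrow> Ck k \<phi>"
proof (induction k arbitrary: \<phi>)
  case 0
  then show ?case by (simp add: smooth_fun_continuous)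
next
  case (Suc k)
  obtain D where D: "\<And>x. (\<phi> has_derivative D x) (at x)" "\<And>v. (\<lambda>x. D x v) \<in> smooth_fun"
    using Suc.prems smooth_fun_derivE by metis
  then have "frechet_derivative \<phi> (at x) = D x" for x
    using frechet_derivative_at by metis
  with D Suc.IH show ?case
    by (auto simp: differentiable_def)
qed

lemma smooth_fun_sum:
  "finite I \<Longrightarrow> (\<And>i. i \<in> I \<Longrightarrow> \<phi> i \<in> smooth_fun) \<Longrightarrow> (\<lambda>x. \<Sum>i\<in>I. \<phi> i x) \<in> smooth_fun"
  by (induction I rule: finite_induct) (simp_all add: smooth_fun.const smooth_fun.add)

lemma smooth_fun_prod:
  "finite I \<Longrightarrow> (\<And>i. i \<in> I \<Longrightarrow> \<phi> i \<in> smooth_fun) \<Longrightarrow> (\<lambda>x. \<Prod>i\<in>I. \<phi> i x) \<in> smooth_fun"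
  by (induction I rule: finite_induct) (simp_all add: smooth_fun.const smooth_fun.mult)

lemma smooth_fun_norm_square: "(\<lambda>x. (norm (x + e))\<^sup>2) \<in> smooth_fun"
proof -
  have "(\<lambda>x. \<Sum>i\<in>Basis. (x \<bullet> i + e \<bullet> i) * (x \<bullet> i + e \<bullet> i)) \<in> smooth_fun"
    by (intro smooth_fun_sum smooth_fun.mult smooth_fun.add smooth_fun.inner smooth_fun.const) simp
  moreover have "(norm (x + e))\<^sup>2 = (\<Sum>i\<in>Basis. (x \<bullet> i + e \<bullet> i) * (x \<bullet> i + e \<bullet> i))" for x :: 'a
    unfolding power2_norm_eq_inner by (subst euclidean_inner) (simp add: inner_add_left)
  ultimately show ?thesis by simp
qed

lemma test_functionsI:
  assumes "\<phi> \<in> smooth_fun" "compact K" "K \<subseteq> S" "\<And>x. x \<notin> K \<Longrightarrow> \<phi> x = 0"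
  shows "\<phi> \<in> test_functions S"
proof -
  have "closure {x. \<phi> x \<noteq> 0} \<subseteq> K"
    using assms by (intro closure_minimal compact_imp_closed) auto
  moreover then have "compact (closure {x. \<phi> x \<noteq> 0})"
    using assms(2) by (meson bounded_subset closed_closure compact_eq_bounded_closed)
  ultimately show ?thesis
    using assms smooth_fun_Ck by (auto simp: test_functions_def)
qed

text \<open>Each coordinate contributes a rising and a falling step of slope proportional to
  \<open>m\<close>, both vanishing outside the box. Inside, every factor is eventually 1; outside,
  some factor is 0, so the closed box serves as compact support.\<close>

lemma test_functions_approx_box:
  assumes "cbox a b \<subseteq> S"
  shows "\<exists>\<Phi>. (\<forall>m. \<Phi> m \<in> test_functions S) \<and> (\<forall>m x. 0 \<le> \<Phi> m x \<and> \<Phi> m x \<le> 1) \<and>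
    (\<forall>m x. x \<notin> box a b \<longrightarrow> \<Phi> m x = 0) \<and>
    (\<forall>x. (\<lambda>m :: nat. \<Phi> m x) \<longlonglongrightarrow> indicator (box a b) x)"
proof -
  obtain s s' where s: "smooth_real s" "\<And>x. (s has_real_derivative s' x) (at x)"
    "\<And>x. x \<le> 0 \<Longrightarrow> s x = 0" "\<And>x. 1 \<le> x \<Longrightarrow> s x = 1" "\<And>x. 0 \<le> s' x"
    using smooth_step_exists by metis
  have mono: "s x \<le> s y" if "x \<le> y" for x y
    using DERIV_nonneg_imp_nondecreasing[OF that] s(2,5) by blast
  have range: "0 \<le> s x" "s x \<le> 1" for x
    using mono[of "min x 0" x] mono[of x "max x 1"] s(3)[of "min x 0"] s(4)[of "max x 1"] by auto
  define \<Phi> where "\<Phi> m x = (\<Prod>i\<in>Basis. s (real m * (x \<bullet> i + - (a \<bullet> i))) *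
      s (real m * ((b \<bullet> i) + (- 1) * (x \<bullet> i))))" for m x
  have smooth_affine: "(\<lambda>x. s (real m * (x \<bullet> i + c))) \<in> smooth_fun"
    "(\<lambda>x. s (real m * (c + (- 1) * (x \<bullet> i)))) \<in> smooth_fun" for m c and i :: 'a
    by (rule smooth_fun.comp[OF s(1)];
        intro smooth_fun.mult smooth_fun.add smooth_fun.inner smooth_fun.const)+
  have zero: "\<Phi> m x = 0" if "x \<notin> box a b" for m x
  proof -
    from that obtain i where i: "i \<in> Basis" "x \<bullet> i \<le> a \<bullet> i \<or> b \<bullet> i \<le> x \<bullet> i"
      by (force simp: mem_box)
    then have "s (real m * (x \<bullet> i + - (a \<bullet> i))) * s (real m * ((b \<bullet> i) + (- 1) * (x \<bullet> i))) = 0"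
      using s(3) by (auto simp: mult_le_0_iff)
    then show ?thesis unfolding \<Phi>_def using i(1) by (intro prod_zero) auto
  qed
  show ?thesis
  proof (intro exI[of _ \<Phi>] conjI allI impI)
    fix m x
    have "\<Phi> m \<in> smooth_fun"
      unfolding \<Phi>_def by (intro smooth_fun_prod smooth_fun.mult smooth_affine finite_Basis)
    then show "\<Phi> m \<in> test_functions S"
      by (rule test_functionsI[OF _ compact_cbox assms]) (use zero box_subset_cbox in blast)
    show "0 \<le> \<Phi> m x"
      unfolding \<Phi>_def by (intro prod_nonneg mult_nonneg_nonneg range)
    show "\<Phi> m x \<le> 1"
      unfolding \<Phi>_def by (intro prod_le_1 conjI mult_le_one mult_nonneg_nonneg range)
    show "\<Phi> m x = 0" if "x \<notin> box a b" using zero that .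
  next
    fix x
    show "(\<lambda>m. \<Phi> m x) \<longlonglongrightarrow> indicator (box a b) x"
    proof (cases "x \<in> box a b")
      case False
      then show ?thesis using zero by simp
    next
      case True
      have "(\<lambda>m. s (real m * t)) \<longlonglongrightarrow> 1" if "t > 0" for t
      proof -
        have "eventually (\<lambda>m. 1 \<le> real m * t) sequentially"
          using eventually_ge_at_top[of "nat \<lceil>1 / t\<rceil>"]
          by eventually_elim (use that in \<open>simp add: field_simps nat_ceiling_le_eq\<close>)
        then show ?thesis
          by (intro tendsto_eventually) (auto elim!: eventually_mono intro: s(4))
      qed
      then have "(\<lambda>m. \<Phi> m x) \<longlonglongrightarrow> (\<Prod>i\<in>(Basis::'a set). 1 * 1)"
        unfolding \<Phi>_def using True by (intro tendsto_prod tendsto_mult) (auto simp: mem_box)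
      then show ?thesis using True by simp
    qed
  qed
qed

lemma test_functions_measurable:
  assumes "\<phi> \<in> test_functions S"
  shows "\<phi> \<in> borel_measurable borel"
proof -
  have "Ck 0 \<phi>"
    using assms unfolding test_functions_def by blast
  then show ?thesis
    by (simp add: borel_measurable_continuous_onI)
qed

lemma integral_lebesgue_on_eq_indicator:
  fixes f :: "'a::euclidean_space \<Rightarrow> 'b::euclidean_space"
  assumes "S \<in> sets lebesgue"
  shows "(LINT x|lebesgue_on S. f x) = (LINT x|lebesgue. indicator S x *\<^sub>R f x)"
  by (rule integral_restrict_space) (use assms in simp)

text \<open>The indicator of the open box is a pointwise limit of test functions with values in
  [0, 1]. Since |g| is integrable on the box, dominated convergence carries the vanishing pairing
  over to it; the faces have measure zero.\<close>

lemma integral_cbox_eq_0_if_test: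
  fixes g :: "'a::euclidean_space \<Rightarrow> real"
  assumes S: "open S" and g: "locally_integrable S g"
    and test: "\<And>\<phi>. \<phi> \<in> test_functions S \<Longrightarrow> (LINT x|lebesgue_on S. g x * \<phi> x) = 0"
    and ab: "cbox a b \<subseteq> S"
  shows "integral (cbox a b) g = 0"
proof -
  obtain \<Phi> where "\<forall>m. \<Phi> m \<in> test_functions S" "\<forall>m x. 0 \<le> \<Phi> m x \<and> \<Phi> m x \<le> 1"
    "\<forall>m x. x \<notin> box a b \<longrightarrow> \<Phi> m x = 0"
    "\<forall>x. (\<lambda>m::nat. \<Phi> m x) \<longlonglongrightarrow> indicator (box a b) x"
    using test_functions_approx_box[OF ab] by (elim exE conjE)
  note \<Phi> = this[rule_format]
  have gi: "g absolutely_integrable_on cbox a b"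
    using g ab compact_cbox unfolding locally_integrable_def by auto
  then have gb: "g absolutely_integrable_on box a b"
    by (rule set_integrable_subset) (auto intro: box_subset_cbox[THEN subsetD])
  have m[measurable]: "(\<lambda>x. indicator (box a b) x *\<^sub>R g x) \<in> borel_measurable lebesgue"
    using gb unfolding set_integrable_def by (rule borel_measurable_integrable)
  have \<Phi>m[measurable]: "\<Phi> m \<in> borel_measurable lebesgue" for m
    using test_functions_measurable[OF \<Phi>(1)] by (simp add: measurable_completion)
  have "(\<lambda>m. LINT x|lebesgue. (indicator (box a b) x *\<^sub>R g x) * \<Phi> m x) \<longlonglongrightarrow>
      (LINT x|lebesgue. indicator (box a b) x *\<^sub>R g x)"
  proof (rule integral_dominated_convergence[where w = "\<lambda>x. norm (indicator (box a b) x *\<^sub>R g x)"])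
    show "integrable lebesgue (\<lambda>x. norm (indicator (box a b) x *\<^sub>R g x))"
      using gb unfolding set_integrable_def by (rule integrable_norm)
    show "AE x in lebesgue. (\<lambda>m. (indicator (box a b) x *\<^sub>R g x) * \<Phi> m x) \<longlonglongrightarrow>
        indicator (box a b) x *\<^sub>R g x"
    proof (rule AE_I2)
      fix x
      have "(\<lambda>m. (indicator (box a b) x *\<^sub>R g x) * \<Phi> m x) \<longlonglongrightarrow>
          (indicator (box a b) x *\<^sub>R g x) * indicator (box a b) x"
        by (intro tendsto_intros \<Phi>(4))
      then show "(\<lambda>m. (indicator (box a b) x *\<^sub>R g x) * \<Phi> m x) \<longlonglongrightarrow>
          indicator (box a b) x *\<^sub>R g x"
        by (cases "x \<in> box a b") simp_all
    qed
    show "AE x in lebesgue. norm ((indicator (box a b) x *\<^sub>R g x) * \<Phi> m x) \<le>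
        norm (indicator (box a b) x *\<^sub>R g x)" for m
      using \<Phi>(2) by (intro AE_I2) (auto simp: abs_mult mult_left_le indicator_def)
  qed (intro borel_measurable_times m \<Phi>m)+
  moreover have "(LINT x|lebesgue. (indicator (box a b) x *\<^sub>R g x) * \<Phi> m x) = 0" for m
  proof -
    have "(LINT x|lebesgue. (indicator (box a b) x *\<^sub>R g x) * \<Phi> m x) =
        (LINT x|lebesgue. indicator S x *\<^sub>R (g x * \<Phi> m x))"
      using \<Phi>(3) ab box_subset_cbox[of a b]
      by (intro Bochner_Integration.integral_cong) (auto simp: indicator_def)
    also have "\<dots> = 0"
      using test[OF \<Phi>(1)] S integral_lebesgue_on_eq_indicator[of S "\<lambda>x. g x * \<Phi> m x"] by auto
    finally show ?thesis .
  qed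
  ultimately have "(LINT x|lebesgue. indicator (box a b) x *\<^sub>R g x) = 0"
    by (simp add: LIMSEQ_const_iff)
  then have "integral (box a b) g = 0"
    using set_lebesgue_integral_eq_integral(2)[OF gb] by (simp add: set_lebesgue_integral_def)
  then show ?thesis
    by (simp add: integral_open_interval)
qed

text \<open>Integrals over all closed boxes in \<open>S\<close> vanish, hence so do the averages
  over shrinking cubes, which recover \<open>g\<close> almost everywhere by Lebesgue
  differentiation.\<close>

lemma fundamental_lemma_variations:
  fixes g :: "'a::euclidean_space \<Rightarrow> real"
  assumes S: "open S" and g: "locally_integrable S g"
    and test: "\<And>\<phi>. \<phi> \<in> test_functions S \<Longrightarrow> (LINT x|lebesgue_on S. g x * \<phi> x) = 0"
  shows "negligible {x \<in> S. g x \<noteq> 0}"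
proof -
  have box: "negligible {x \<in> cbox a b. g x \<noteq> 0}" if ab: "cbox a b \<subseteq> S" for a b
  proof -
    have gi: "g absolutely_integrable_on cbox a b"
      using g ab compact_cbox unfolding locally_integrable_def by auto
    \<comment> \<open>The differentiation theorem asks for integrability on every box, including
      boxes that leave \<open>S\<close>; hence the extension by zero.\<close>
    then have "(\<lambda>x. if x \<in> cbox a b then g x else 0) integrable_on UNIV"
      using set_lebesgue_integral_eq_integral(1) integrable_restrict_UNIV by blast
    then have "(\<lambda>x. if x \<in> cbox a b then g x else 0) integrable_on cbox c d" for c d
      by (rule integrable_on_subcbox) auto
    then obtain N where N: "negligible N" "\<And>x e. \<lbrakk>x \<notin> N; 0 < e\<rbrakk> \<Longrightarrow>
        \<exists>d>0. \<forall>h. 0 < h \<and> h < d \<longrightarrow> norm (integral (cbox x (x + h *\<^sub>R One))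
          (\<lambda>x. if x \<in> cbox a b then g x else 0) /\<^sub>R h ^ DIM('a) -
            (if x \<in> cbox a b then g x else 0)) < e"
      using integrable_ccontinuous_explicit by blast
    have "g x = 0" if x: "x \<in> box a b" "x \<notin> N" for x
    proof (rule ccontr)
      assume "g x \<noteq> 0"
      then obtain d where d: "d > 0" "\<And>h. 0 < h \<Longrightarrow> h < d \<Longrightarrow> norm (integral (cbox x (x + h *\<^sub>R One))
          (\<lambda>x. if x \<in> cbox a b then g x else 0) /\<^sub>R h ^ DIM('a) -
            (if x \<in> cbox a b then g x else 0)) < norm (g x)"
        using N(2)[OF x(2), of "norm (g x)"] by auto
      have xb: "x \<in> cbox a b" using x(1) box_subset_cbox by blast
      \<comment> \<open>The cubes grow from their lower corner \<open>x\<close>, so only the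
        distance to the upper faces of the box limits their side length.\<close>
      obtain \<epsilon> where \<epsilon>: "\<epsilon> > 0" "\<And>i. i \<in> Basis \<Longrightarrow> x \<bullet> i + \<epsilon> \<le> b \<bullet> i"
      proof
        let ?m = "Min ((\<lambda>i. b \<bullet> i - x \<bullet> i) ` Basis)"
        show "?m > 0" using x(1) by (subst Min_gr_iff) (auto simp: mem_box)
        show "x \<bullet> i + ?m \<le> b \<bullet> i" if "i \<in> Basis" for i
        proof -
          have "?m \<le> b \<bullet> i - x \<bullet> i"
            by (rule Min_le) (use that in auto)
          then show ?thesis by simp
        qed
      qed
      define h where "h = min \<epsilon> (d / 2)"
      have h: "0 < h" "h < d" "h \<le> \<epsilon>" using \<open>d > 0\<close> \<epsilon>(1) by (auto simp: h_def)
      have sub: "cbox x (x + h *\<^sub>R One) \<subseteq> cbox a b"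
      proof (clarsimp simp: mem_box inner_add_left)
        fix y i assume y: "\<forall>i\<in>Basis. x \<bullet> i \<le> y \<bullet> i \<and> y \<bullet> i \<le> x \<bullet> i + h" and i: "(i::'a) \<in> Basis"
        show "a \<bullet> i \<le> y \<bullet> i \<and> y \<bullet> i \<le> b \<bullet> i"
          using bspec[OF y i] \<epsilon>(2)[OF i] h(3) x(1) i by (force simp: mem_box)
      qed
      have "integral (cbox x (x + h *\<^sub>R One)) (\<lambda>x. if x \<in> cbox a b then g x else 0) =
          integral (cbox x (x + h *\<^sub>R One)) g"
        using sub by (intro integral_cong) auto
      also have "\<dots> = 0"
        using sub ab by (intro integral_cbox_eq_0_if_test[OF S g test]) auto
      finally show False
        using d(2)[OF h(1,2)] xb by simp
    qed
    \<comment> \<open>Points on the faces escape the argument, but they form a negligible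
      set.\<close>
    then have "{x \<in> cbox a b. g x \<noteq> 0} \<subseteq> N \<union> (cbox a b - box a b)"
      by blast
    moreover have "negligible (N \<union> (cbox a b - box a b))"
      by (intro negligible_Un N(1) negligible_frontier_interval)
    ultimately show ?thesis
      by (rule negligible_subset[rotated])
  qed
  obtain \<D> where \<D>: "countable \<D>" "\<D> \<subseteq> Pow S" "\<And>X. X \<in> \<D> \<Longrightarrow> \<exists>a b. X = cbox a b"
    "\<Union>\<D> = S"
    by (rule open_countable_Union_open_cbox[OF S]) blast
  have "negligible {x \<in> X. g x \<noteq> 0}" if X: "X \<in> \<D>" for X
  proof -
    obtain a b where "X = cbox a b" using \<D>(3)[OF X] by blast
    then show ?thesis using box[of a b] X \<D>(2) by auto
  qed
  then have "negligible (\<Union>X\<in>\<D>. {x \<in> X. g x \<noteq> 0})"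
    using \<D>(1) by (intro negligible_countable_Union) auto
  moreover have "{x \<in> S. g x \<noteq> 0} = (\<Union>X\<in>\<D>. {x \<in> X. g x \<noteq> 0})"
    using \<D>(4) by auto
  ultimately show ?thesis by simp
qed

section \<open>Integral estimates and weak gradients\<close>

text \<open>Integrability comes from Young's inequality applied pointwise. The sharp bound comes
  from applying it after scaling both functions to unit norm; a zero norm forbids this scaling, but
  then the integrand vanishes almost everywhere.\<close>

lemma Hoelder_inner:
  fixes f g :: "'a::euclidean_space \<Rightarrow> 'b::euclidean_space"
  assumes pq: "1 < p" "1 < q" "1 / p + 1 / q = 1"
    and f: "f \<in> Lp_space S p" and g: "g \<in> Lp_space S q"
  shows "integrable (lebesgue_on S) (\<lambda>x. f x \<bullet> g x)" (is ?I)
    and "\<bar>LINT x|lebesgue_on S. f x \<bullet> g x\<bar> \<le> Lp_norm S p f * Lp_norm S q g" (is ?B)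
proof -
  let ?M = "lebesgue_on S"
  have [measurable]: "f \<in> borel_measurable ?M" "g \<in> borel_measurable ?M"
    and fi: "integrable ?M (\<lambda>x. norm (f x) powr p)" and gi: "integrable ?M (\<lambda>x. norm (g x) powr q)"
    using f g by (auto simp: Lp_space_def)
  have le: "\<bar>f x \<bullet> g x\<bar> \<le> norm (f x) powr p / p + norm (g x) powr q / q" for x
    using Cauchy_Schwarz_ineq2[of "f x" "g x"]
      Youngs_inequality[OF pq, of "norm (f x)" "norm (g x)"] by simp
  show I: ?I
    by (rule Bochner_Integration.integrable_bound[of _ "\<lambda>x. norm (f x) powr p / p + norm (g x) powr q / q"])
      (use fi gi le pq in auto)
  define A where "A = (LINT x|?M. norm (f x) powr p)"
  define B where "B = (LINT x|?M. norm (g x) powr q)"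
  have AB: "A \<ge> 0" "B \<ge> 0" unfolding A_def B_def by auto
  show ?B
  proof (cases "A = 0 \<or> B = 0")
    case True
    then have "AE x in ?M. norm (f x) powr p = 0 \<or> norm (g x) powr q = 0"
    proof
      assume "A = 0"
      then have "AE x in ?M. norm (f x) powr p = 0"
        using integral_nonneg_eq_0_iff_AE[OF fi] unfolding A_def by simp
      then show ?thesis by (rule AE_mp) simp
    next
      assume "B = 0"
      then have "AE x in ?M. norm (g x) powr q = 0"
        using integral_nonneg_eq_0_iff_AE[OF gi] unfolding B_def by simp
      then show ?thesis by (rule AE_mp) simp
    qed
    then have "AE x in ?M. f x \<bullet> g x = 0"
      by (rule AE_mp) (intro AE_I2, auto)
    then have "(LINT x|?M. f x \<bullet> g x) = 0"
      by (rule integral_eq_zero_AE)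
    then show ?thesis by (simp add: Lp_norm_def)
  next
    case False
    with AB have AB': "A > 0" "B > 0" by auto
    define a where "a = A powr (1 / p)"
    define b where "b = B powr (1 / q)"
    have ab: "a > 0" "b > 0" using AB' by (auto simp: a_def b_def)
    have ap: "a powr p = A" "b powr q = B"
      using AB' pq by (auto simp: a_def b_def powr_powr)
    have "\<bar>f x \<bullet> g x\<bar> \<le> a * b * (norm (f x) powr p / (A * p) + norm (g x) powr q / (B * q))" for x
    proof -
      have "\<bar>f x \<bullet> g x\<bar> \<le> a * b * ((norm (f x) / a) * (norm (g x) / b))"
        using Cauchy_Schwarz_ineq2[of "f x" "g x"] ab by simp
      also have "\<dots> \<le> a * b * ((norm (f x) / a) powr p / p + (norm (g x) / b) powr q / q)"
        by (intro mult_left_mono Youngs_inequality pq) (use ab in auto)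
      finally show ?thesis
        using ab ap by (simp add: powr_divide mult.commute)
    qed
    then have "(LINT x|?M. \<bar>f x \<bullet> g x\<bar>) \<le>
        (LINT x|?M. a * b * (norm (f x) powr p / (A * p) + norm (g x) powr q / (B * q)))"
      using I fi gi by (intro integral_mono) auto
    also have "\<dots> = a * b * (A / (A * p) + B / (B * q))"
      using fi gi by (simp add: A_def B_def)
    also have "\<dots> = a * b" using AB' pq by simp
    finally have "\<bar>LINT x|?M. f x \<bullet> g x\<bar> \<le> a * b"
      using integral_abs_bound[of ?M "\<lambda>x. f x \<bullet> g x"] by linarith
    then show ?thesis by (simp add: a_def b_def A_def B_def Lp_norm_def)
  qed
qed

text \<open>Strong convergence implies weak convergence; this is how the approximations defining the
  trace enter the integral identities.\<close>

lemma Lp_tendsto_inner: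
  fixes U :: "nat \<Rightarrow> 'a::euclidean_space \<Rightarrow> 'b::euclidean_space"
  assumes pq: "1 < p" "1 < q" "1 / p + 1 / q = 1"
    and U: "Lp_tendsto S p U u" and g: "g \<in> Lp_space S q"
  shows "(\<lambda>k. LINT x|lebesgue_on S. (U k x - u x) \<bullet> g x) \<longlonglongrightarrow> 0"
proof (rule Lim_null_comparison)
  show "eventually (\<lambda>k. norm (LINT x|lebesgue_on S. (U k x - u x) \<bullet> g x) \<le>
      Lp_norm S p (\<lambda>x. U k x - u x) * Lp_norm S q g) sequentially"
    using Hoelder_inner(2)[OF pq _ g] U by (simp add: Lp_tendsto_def)
  show "(\<lambda>k. Lp_norm S p (\<lambda>x. U k x - u x) * Lp_norm S q g) \<longlonglongrightarrow> 0"
    using U unfolding Lp_tendsto_def by (auto intro: tendsto_mult_left_zero)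
qed

text \<open>Dyadic comparison: the function is dominated by a series of indicators of balls of
  radius 2^(k+1) with weights c^k, c = 2 powr (- a). The integrals form a geometric series with
  ratio \<open>c * 2 ^ DIM('a)\<close>, below 1 because \<open>a\<close> exceeds the
  dimension.\<close>

lemma integrable_one_plus_norm_powr:
  assumes "real DIM('a) < a"
  shows "integrable lborel (\<lambda>z :: 'a::euclidean_space. (1 + norm z) powr (- a))"
proof -
  define c where "c = (2::real) powr (- a)"
  have c: "0 < c" "c < 1" and cN: "c * 2 ^ DIM('a) < 1"
  proof -
    show "0 < c" by (simp add: c_def)
    have "c < 2 powr 0" unfolding c_def using assms by (intro powr_less_mono) auto
    then show "c < 1" by simp
    have "c * 2 ^ DIM('a) = 2 powr (real DIM('a) - a)"
      by (simp add: c_def powr_diff powr_minus powr_realpow field_simps)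
    also have "\<dots> < 2 powr 0" using assms by (intro powr_less_mono) auto
    finally show "c * 2 ^ DIM('a) < 1" by simp
  qed
  have ck: "c ^ k = (2 ^ k) powr (- a)" for k
    by (simp add: c_def powr_realpow[symmetric] powr_powr mult.commute)
  define F where "F k z = c ^ k * indicator (ball 0 (2 ^ Suc k)) z" for k and z :: 'a
  have sF: "summable (\<lambda>k. norm (F k z))" for z
    by (rule summable_comparison_test'[of "\<lambda>k. c ^ k" 0])
      (use c in \<open>auto simp: F_def indicator_def intro: summable_geometric\<close>)
  have iF: "integrable lborel (F k)" for k
    unfolding F_def by (intro integrable_mult_right integrable_real_indicator)
      (auto simp: emeasure_ball)
  have "integrable lborel (\<lambda>z. \<Sum>k. F k z)"
  proof (rule integrable_suminf[OF iF])
    show "AE z in lborel. summable (\<lambda>k. norm (F k z))" using sF by simp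
    have "(LINT z|lborel. norm (F k z)) = unit_ball_vol (real DIM('a)) * 2 ^ DIM('a) *
        (c * 2 ^ DIM('a)) ^ k" for k
    proof -
      have "(LINT z|lborel. norm (F k z)) = c ^ k * measure lborel (ball (0::'a) (2 ^ Suc k))"
        using c by (simp add: F_def abs_mult)
      also have "\<dots> = c ^ k * (unit_ball_vol (real DIM('a)) * (2 ^ Suc k) ^ DIM('a))"
        by (subst content_ball) auto
      also have "((2::real) ^ Suc k) ^ DIM('a) = 2 ^ DIM('a) * (2 ^ DIM('a)) ^ k"
        by (metis power_Suc power_mult mult.commute)
      finally show ?thesis by (simp add: power_mult_distrib algebra_simps)
    qed
    then show "summable (\<lambda>k. LINT z|lborel. norm (F k z))"
      using c cN by (simp add: summable_geometric)
  qed
  then show ?thesis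
  proof (rule Bochner_Integration.integrable_bound)
    show "AE z :: 'a in lborel. norm ((1 + norm z) powr (- a)) \<le> norm (\<Sum>k. F k z)"
    proof (rule AE_I2)
      fix z :: 'a
      \<comment> \<open>The dyadic shell of \<open>z\<close> is located by minimality; the single
        term \<open>F k z\<close> of the nonnegative series already dominates the function.\<close>
      obtain k :: nat where k: "2 ^ k \<le> 1 + norm z" "1 + norm z < 2 ^ Suc k"
      proof -
        obtain m :: nat where m: "1 + norm z < 2 ^ m"
          using real_arch_pow[of 2 "1 + norm z"] by auto
        define l where "l = (LEAST m. 1 + norm z < 2 ^ m)"
        have l: "1 + norm z < 2 ^ l" unfolding l_def using m by (rule LeastI)
        have "l \<noteq> 0" using l by (intro notI) (simp add: not_less[symmetric])
        then obtain k where k: "l = Suc k" using not0_implies_Suc by blast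
        have "\<not> 1 + norm z < 2 ^ k" 
          using not_less_Least[of k "\<lambda>m. 1 + norm z < 2 ^ m"] k unfolding l_def by simp
        then show thesis using that[of k] l k by simp
      qed
      have "(1 + norm z) powr (- a) \<le> (2 ^ k) powr (- a)"
        by (rule powr_mono2') (use assms k in auto)
      also have "\<dots> = F k z" using k by (simp add: F_def ck)
      also have "\<dots> = (\<Sum>j\<in>{k}. F j z)" by simp
      also have "\<dots> \<le> (\<Sum>k. F k z)"
        using summable_norm_cancel[OF sF] c by (intro sum_le_suminf) (auto simp: F_def)
      finally show "norm ((1 + norm z) powr (- a)) \<le> norm (\<Sum>k. F k z)" by simp
    qed
  qed auto
qed

text \<open>The difference quotients in direction \<open>v\<close> have integral 0 by translation
  invariance. They are uniformly bounded by the mean value theorem and supported in one ball, so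
  dominated convergence gives the same for the derivative.\<close>

lemma integral_directional_derivative_eq_0:
  fixes \<psi> :: "'a::euclidean_space \<Rightarrow> real"
  assumes D: "\<And>x. (\<psi> has_derivative D x) (at x)" and cont: "continuous_on UNIV (\<lambda>x. D x v)"
    and K: "compact K" and zero: "\<And>x. x \<notin> K \<Longrightarrow> \<psi> x = 0"
  shows "(LINT x|lborel. D x v) = 0"
proof -
  have c\<psi>: "continuous_on UNIV \<psi>"
    using D by (meson has_derivative_continuous continuous_at_imp_continuous_on)
  have zeroD: "D x v = 0" if "x \<notin> K" for x
  proof -
    have "((\<lambda>x. 0) has_derivative (\<lambda>v. 0)) (at x)" by simp
    then have "(\<psi> has_derivative (\<lambda>v. 0)) (at x)"
      by (rule has_derivative_transform_within_open[of _ _ _ _ "- K"])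
        (use that zero K compact_imp_closed in auto)
    then show ?thesis using has_derivative_unique[OF D] by metis
  qed
  obtain B where B: "\<And>x. \<bar>D x v\<bar> \<le> B" "B \<ge> 0"
  proof -
    have "bounded ((\<lambda>x. D x v) ` K)"
      by (intro compact_imp_bounded compact_continuous_image continuous_on_subset[OF cont] K) auto
    then obtain B where "B > 0" "\<And>x. x \<in> K \<Longrightarrow> \<bar>D x v\<bar> \<le> B"
      unfolding bounded_pos by auto
    then have "\<bar>D x v\<bar> \<le> B" for x by (cases "x \<in> K") (use zeroD in auto)
    then show thesis using that[of B] \<open>B > 0\<close> by auto
  qed
  obtain R where R: "K \<subseteq> cball 0 R"
    using compact_imp_bounded[OF K] by (auto simp: bounded_iff subset_iff)
  \<comment> \<open>Step sizes at most 1 keep the supports of all quotients inside the ball of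
    radius \<open>R + norm v\<close>.\<close>
  define h where "h k = 1 / real (Suc k)" for k
  have h: "0 < h k" "h k \<le> 1" for k by (auto simp: h_def)
  have hlim: "h \<longlonglongrightarrow> 0" unfolding h_def by (rule lim_1_over_n[THEN LIMSEQ_Suc])
  define Q where "Q k x = (\<psi> (x + h k *\<^sub>R v) - \<psi> x) / h k" for k x
  have i\<psi>: "integrable lborel \<psi>"
  proof -
    have "integrable lborel (\<lambda>x. indicator K x *\<^sub>R \<psi> x)"
      using borel_integrable_compact[OF K continuous_on_subset[OF c\<psi>]] by simp
    then show ?thesis
      by (rule Bochner_Integration.integrable_cong[THEN iffD1, rotated -1])
        (use zero in \<open>auto simp: indicator_def\<close>)
  qed
  have trans: "integrable lborel (\<lambda>x. \<psi> (x + c))" "(LINT x|lborel. \<psi> (x + c)) = (LINT x|lborel. \<psi> x)" for c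
  proof -
    have m: "\<psi> \<in> borel_measurable borel" using c\<psi> by (rule borel_measurable_continuous_onI)
    have "integrable (distr lborel borel ((+) c)) \<psi>" using i\<psi> lborel_distr_plus[of c] by simp
    then show "integrable lborel (\<lambda>x. \<psi> (x + c))"
      by (subst (asm) integrable_distr_eq) (use m in \<open>auto simp: add.commute\<close>)
    have "(LINT x|distr lborel borel ((+) c). \<psi> x) = (LINT x|lborel. \<psi> (c + x))"
      by (subst integral_distr) (use m in auto)
    then show "(LINT x|lborel. \<psi> (x + c)) = (LINT x|lborel. \<psi> x)"
      using lborel_distr_plus[of c] by (simp add: add.commute)
  qed
  have Q0: "(LINT x|lborel. Q k x) = 0" for k
    unfolding Q_def using trans i\<psi> by simp
  have line: "((\<lambda>t. \<psi> (x + t *\<^sub>R v)) has_real_derivative D (x + t *\<^sub>R v) v) (at t)" for x t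
  proof -
    have "((\<lambda>t. x + t *\<^sub>R v) has_derivative (\<lambda>s. s *\<^sub>R v)) (at t)"
      by (auto intro!: derivative_eq_intros)
    from has_derivative_compose[OF this D]
    have "((\<lambda>t. \<psi> (x + t *\<^sub>R v)) has_derivative (\<lambda>s. D (x + t *\<^sub>R v) (s *\<^sub>R v))) (at t)" .
    moreover have "D (x + t *\<^sub>R v) (s *\<^sub>R v) = D (x + t *\<^sub>R v) v * s" for s
      using linear_cmul[OF has_derivative_linear[OF D]] by (simp add: mult.commute)
    ultimately show ?thesis by (simp add: has_field_derivative_def)
  qed
  have Qlim: "(\<lambda>k. Q k x) \<longlonglongrightarrow> D x v" for x
  proof -
    have "((\<lambda>t. (\<psi> (x + t *\<^sub>R v) - \<psi> x) / t) \<longlongrightarrow> D x v) (at 0)"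
      using line[of x 0] by (simp add: has_field_derivative_iff)
    moreover have "filterlim h (at 0) sequentially"
      unfolding filterlim_at using hlim h by (auto simp: less_imp_neq[symmetric])
    ultimately show ?thesis
      unfolding Q_def by (rule filterlim_compose)
  qed
  have Qbound: "\<bar>Q k x\<bar> \<le> B" for k x
  proof -
    obtain z where "\<psi> (x + h k *\<^sub>R v) - \<psi> (x + 0 *\<^sub>R v) = (h k - 0) * D (x + z *\<^sub>R v) v"
      using MVT2[of 0 "h k" "\<lambda>t. \<psi> (x + t *\<^sub>R v)" "\<lambda>t. D (x + t *\<^sub>R v) v"] h[of k] line by auto
    then have "Q k x = D (x + z *\<^sub>R v) v" using h[of k] by (simp add: Q_def)
    then show ?thesis using B by simp
  qed
  have Qzero: "Q k x = 0" if "x \<notin> cball 0 (R + norm v)" for k x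
  proof -
    have "norm (h k *\<^sub>R v) \<le> norm v"
      using h[of k] by (simp add: mult_left_le_one_le)
    moreover have "norm x \<le> norm (x + h k *\<^sub>R v) + norm (h k *\<^sub>R v)"
      using norm_triangle_ineq4[of "x + h k *\<^sub>R v" "h k *\<^sub>R v"] by simp
    ultimately have "x + h k *\<^sub>R v \<notin> K" "x \<notin> K"
      using that subsetD[OF R, of x] subsetD[OF R, of "x + h k *\<^sub>R v"] norm_ge_zero[of v]
      unfolding mem_cball_0 by linarith+
    then show ?thesis using zero by (simp add: Q_def)
  qed
  have mQ: "Q k \<in> borel_measurable lborel" for k
  proof -
    have "continuous_on UNIV (Q k)"
      unfolding Q_def using h[of k]
      by (intro continuous_intros continuous_on_compose2[OF c\<psi>]) auto
    then show ?thesis by (simp add: borel_measurable_continuous_onI)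
  qed
  have "(\<lambda>k. LINT x|lborel. Q k x) \<longlonglongrightarrow> (LINT x|lborel. D x v)"
  proof (rule integral_dominated_convergence[where w = "\<lambda>x. B * indicator (cball 0 (R + norm v)) x"])
    show "(\<lambda>x. D x v) \<in> borel_measurable lborel"
      using cont by (simp add: borel_measurable_continuous_onI)
    show "integrable lborel (\<lambda>x::'a. B * indicator (cball 0 (R + norm v)) x)"
      by (intro integrable_mult_right integrable_real_indicator)
        (use emeasure_lborel_cball_finite[of "0::'a" "R + norm v"] in simp_all)
    show "AE x in lborel. norm (Q k x) \<le> B * indicator (cball 0 (R + norm v)) x" for k
      using Qbound Qzero by (intro AE_I2) (auto simp: indicator_def)
  qed (use mQ Qlim in auto)
  then show ?thesis
    unfolding Q0 by (simp add: LIMSEQ_const_iff)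
qed


section \<open>Pairings with test functions and uniqueness of weak gradients\<close>

lemma test_functionsE:
  assumes \<phi>: "\<phi> \<in> test_functions S"
  obtains D K where "compact K" "K \<subseteq> S" "\<And>x. x \<notin> K \<Longrightarrow> \<phi> x = 0" "\<And>x v. x \<notin> K \<Longrightarrow> D x v = 0"
    "\<And>x. (\<phi> has_derivative D x) (at x)" "\<And>x. frechet_derivative \<phi> (at x) = D x"
    "\<And>i. i \<in> Basis \<Longrightarrow> continuous_on UNIV (\<lambda>x. D x i)" "continuous_on UNIV \<phi>"
proof -
  define K where "K = closure {x. \<phi> x \<noteq> 0}"
  define D where "D x = frechet_derivative \<phi> (at x)" for x
  have K: "compact K" "K \<subseteq> S" and Ck: "Ck 0 \<phi>" "Ck (Suc 0) \<phi>"
    using \<phi> unfolding test_functions_def K_def by blast+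
  have zero: "\<phi> x = 0" if "x \<notin> K" for x
    using that closure_subset[of "{x. \<phi> x \<noteq> 0}"] unfolding K_def by auto
  have deriv: "(\<phi> has_derivative D x) (at x)" for x
    using Ck(2) unfolding D_def by (simp add: frechet_derivative_works[symmetric])
  have zeroD: "D x v = 0" if "x \<notin> K" for x v
  proof -
    have "((\<lambda>x. 0) has_derivative (\<lambda>v. 0)) (at x)" by simp
    then have "(\<phi> has_derivative (\<lambda>v. 0)) (at x)"
      by (rule has_derivative_transform_within_open[of _ _ _ _ "- K"])
        (use that zero K compact_imp_closed in auto)
    then show ?thesis using has_derivative_unique[OF deriv] by metis
  qed
  show thesis
    by (rule that[of K D]) (use K zero zeroD deriv Ck in \<open>auto simp: D_def\<close>)
qed

lemma compact_support_bounded: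
  fixes \<phi> :: "'a::metric_space \<Rightarrow> real"
  assumes "continuous_on UNIV \<phi>" "compact K" "\<And>x. x \<notin> K \<Longrightarrow> \<phi> x = 0"
  obtains B where "\<And>x. \<bar>\<phi> x\<bar> \<le> B" "B \<ge> 0"
proof -
  have "bounded (\<phi> ` K)"
    by (intro compact_imp_bounded compact_continuous_image continuous_on_subset[OF assms(1)] assms(2)) auto
  then obtain B where "B > 0" "\<And>x. x \<in> K \<Longrightarrow> \<bar>\<phi> x\<bar> \<le> B"
    unfolding bounded_pos by auto
  then have "\<bar>\<phi> x\<bar> \<le> B" for x by (cases "x \<in> K") (use assms(3) in auto)
  then show thesis using that[of B] \<open>B > 0\<close> by auto
qed

lemma integrable_mult_compact_support:
  fixes g \<phi> :: "'a::euclidean_space \<Rightarrow> real"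
  assumes g: "g absolutely_integrable_on K" and \<phi>: "continuous_on UNIV \<phi>"
    and K: "compact K" "K \<subseteq> S" "\<And>x. x \<notin> K \<Longrightarrow> \<phi> x = 0" and S: "S \<in> sets lebesgue"
  shows "integrable (lebesgue_on S) (\<lambda>x. g x * \<phi> x)"
proof -
  obtain B where B: "\<And>x. \<bar>\<phi> x\<bar> \<le> B" "B \<ge> 0"
    using compact_support_bounded[OF \<phi> K(1,3)] by blast
  have i: "integrable lebesgue (\<lambda>x. indicator K x *\<^sub>R g x)"
    using g by (simp add: set_integrable_def)
  have m: "\<phi> \<in> borel_measurable lebesgue"
    using \<phi> by (simp add: borel_measurable_continuous_onI measurable_completion)
  have "integrable lebesgue (\<lambda>x. (indicator K x *\<^sub>R g x) * \<phi> x)"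
  proof (rule Bochner_Integration.integrable_bound)
    show "integrable lebesgue (\<lambda>x. (indicator K x *\<^sub>R g x) * B)"
      using i by (rule integrable_mult_left)
    show "(\<lambda>x. (indicator K x *\<^sub>R g x) * \<phi> x) \<in> borel_measurable lebesgue"
      by (intro borel_measurable_times m borel_measurable_integrable[OF i])
    show "AE x in lebesgue. norm ((indicator K x *\<^sub>R g x) * \<phi> x) \<le>
        norm ((indicator K x *\<^sub>R g x) * B)"
      by (intro AE_I2) (use B in \<open>auto simp: abs_mult intro!: mult_left_mono\<close>)
  qed
  moreover have "(\<lambda>x. (indicator K x *\<^sub>R g x) * \<phi> x) = (\<lambda>x. indicator S x *\<^sub>R (g x * \<phi> x))"
    using K(2,3) by (auto simp: indicator_def fun_eq_iff)
  ultimately show ?thesis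
    using S by (subst integrable_restrict_space) simp_all
qed

lemma locally_integrable_continuous:
  fixes h :: "'a::euclidean_space \<Rightarrow> 'b::euclidean_space"
  assumes "continuous_on S h"
  shows "locally_integrable S h"
  unfolding locally_integrable_def
proof (intro allI impI)
  fix K assume K: "compact K \<and> K \<subseteq> S"
  then have i: "integrable lborel (\<lambda>x. indicator K x *\<^sub>R h x)"
    using assms by (intro borel_integrable_compact) (auto intro: continuous_on_subset)
  then show "h absolutely_integrable_on K"
    unfolding set_integrable_def
    by (subst integrable_completion) (auto dest: borel_measurable_integrable)
qed

lemma locally_integrable_inner:
  assumes "locally_integrable S g"
  shows "locally_integrable S (\<lambda>x. g x \<bullet> i)"
  using assms unfolding locally_integrable_def by (auto intro: absolutely_integrable_component)

text \<open>Both gradients satisfy the same integral identity, so the fundamental lemma applies to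
  every component of their difference.\<close>

lemma weak_gradient_unique:
  assumes S: "open S" and g: "is_weak_gradient S u g" and g': "is_weak_gradient S u g'"
  shows "negligible {x \<in> S. g x \<noteq> g' x}"
proof -
  have i: "negligible {x \<in> S. g x \<bullet> i - g' x \<bullet> i \<noteq> 0}" if i: "i \<in> Basis" for i
  proof (rule fundamental_lemma_variations[OF S])
    have l: "locally_integrable S (\<lambda>x. g x \<bullet> i)" "locally_integrable S (\<lambda>x. g' x \<bullet> i)"
      using g g' by (auto simp: is_weak_gradient_def intro: locally_integrable_inner)
    then show "locally_integrable S (\<lambda>x. g x \<bullet> i - g' x \<bullet> i)"
      unfolding locally_integrable_def by (auto intro: set_integral_diff)
    fix \<phi> assume \<phi>: "\<phi> \<in> test_functions S"
    have "integrable (lebesgue_on S) (\<lambda>x. (h x \<bullet> i) * \<phi> x)"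
      if "locally_integrable S (\<lambda>x. h x \<bullet> i)" for h
    proof (rule test_functionsE[OF \<phi>])
      fix K assume "compact K" "K \<subseteq> S" "\<And>x. x \<notin> K \<Longrightarrow> \<phi> x = 0" "continuous_on UNIV \<phi>"
      then show ?thesis
        using that S unfolding locally_integrable_def
        by (intro integrable_mult_compact_support[where K = K]) auto
    qed
    then have "(LINT x|lebesgue_on S. (g x \<bullet> i - g' x \<bullet> i) * \<phi> x) =
        (LINT x|lebesgue_on S. (g x \<bullet> i) * \<phi> x) - (LINT x|lebesgue_on S. (g' x \<bullet> i) * \<phi> x)"
      using l by (simp add: left_diff_distrib)
    also have "\<dots> = 0"
      using g g' \<phi> i unfolding is_weak_gradient_def by force
    finally show "(LINT x|lebesgue_on S. (g x \<bullet> i - g' x \<bullet> i) * \<phi> x) = 0" .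
  qed
  have "{x \<in> S. g x \<noteq> g' x} = (\<Union>i\<in>Basis. {x \<in> S. g x \<bullet> i - g' x \<bullet> i \<noteq> 0})"
    by (auto simp: euclidean_eq_iff[of "g _" "g' _"])
  then show ?thesis
    using i by (auto intro!: negligible_Union)
qed

text \<open>This allows the gradient picked by \<open>SOME\<close> to be replaced by an explicit one
  inside integrals, in particular in the energy of \<open>f\<close>.\<close>

lemma weak_gradient_AE_eq:
  assumes S: "open S" and g: "is_weak_gradient S u g"
  shows "AE x in lebesgue_on S. weak_gradient S u x = g x"
proof -
  have "is_weak_gradient S u (weak_gradient S u)"
    using someI[of "is_weak_gradient S u", OF g] by (simp add: weak_gradient_def)
  then have "negligible {x \<in> S. weak_gradient S u x \<noteq> g x}"
    using weak_gradient_unique[OF S _ g] by blast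
  then have "AE x in lebesgue. x \<notin> {x \<in> S. weak_gradient S u x \<noteq> g x}"
    by (intro AE_not_in) (simp add: negligible_iff_null_sets)
  then show ?thesis
    using S by (subst AE_restrict_space_iff) (auto elim!: AE_mp)
qed

text \<open>The product of \<open>u\<close> with a test function, extended by zero, has compact
  support and continuous partial derivatives, so each of these integrates to 0; the product rule
  splits this into the two sides of the weak identity.\<close>

lemma is_weak_gradient_classical:
  fixes u :: "'a::euclidean_space \<Rightarrow> real"
  assumes S: "open S" and u: "\<And>x. x \<in> S \<Longrightarrow> (u has_derivative (\<lambda>v. G x \<bullet> v)) (at x)"
    and G: "continuous_on S G"
  shows "is_weak_gradient S u G"
  unfolding is_weak_gradient_def
proof (intro conjI ballI)
  have cu: "continuous_on S u"
    using u by (meson has_derivative_continuous continuous_at_imp_continuous_on)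
  have lu: "locally_integrable S u" and lG: "locally_integrable S G"
    using cu G by (auto intro: locally_integrable_continuous)
  then show "locally_integrable S u" "locally_integrable S G" .
  fix \<phi> :: "'a \<Rightarrow> real" and i :: 'a assume \<phi>: "\<phi> \<in> test_functions S" and i: "i \<in> Basis"
  obtain D K where K: "compact K" "K \<subseteq> S" "\<And>x. x \<notin> K \<Longrightarrow> \<phi> x = 0" "\<And>x v. x \<notin> K \<Longrightarrow> D x v = 0"
    and D: "\<And>x. (\<phi> has_derivative D x) (at x)" "\<And>x. frechet_derivative \<phi> (at x) = D x"
      "continuous_on UNIV (\<lambda>x. D x i)" and c\<phi>: "continuous_on UNIV \<phi>"
    using test_functionsE[OF \<phi>] i by metis
  define \<psi> where "\<psi> x = (if x \<in> S then u x * \<phi> x else 0)" for x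
  define E where "E x v = (if x \<in> S then u x * D x v + (G x \<bullet> v) * \<phi> x else 0)" for x v
  \<comment> \<open>The open sets \<open>S\<close> and \<open>- K\<close> cover the space. On the
    first the product rule applies, on the second \<open>\<psi>\<close> is identically 0, so
    regularity across the boundary of \<open>S\<close> costs nothing.\<close>
  have oK: "open (- K)" using K(1) by (simp add: compact_imp_closed open_Compl)
  have "(\<psi> has_derivative E x) (at x)" for x
  proof (cases "x \<in> S")
    case True
    have "((\<lambda>x. u x * \<phi> x) has_derivative (\<lambda>v. u x * D x v + (G x \<bullet> v) * \<phi> x)) (at x)"
      by (rule has_derivative_mult[OF u[OF True] D(1)])
    then have "(\<psi> has_derivative (\<lambda>v. u x * D x v + (G x \<bullet> v) * \<phi> x)) (at x)"
      by (rule has_derivative_transform_within_open[OF _ S True]) (simp add: \<psi>_def)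
    then show ?thesis using True by (simp add: E_def[abs_def])
  next
    case False
    have "((\<lambda>x. 0) has_derivative (\<lambda>v. 0)) (at x)" by simp
    then have "(\<psi> has_derivative (\<lambda>v. 0)) (at x)"
      by (rule has_derivative_transform_within_open[OF _ oK]) (use False K in \<open>auto simp: \<psi>_def\<close>)
    then show ?thesis using False by (simp add: E_def[abs_def])
  qed
  moreover have "continuous_on UNIV (\<lambda>x. E x i)"
  proof -
    have "continuous_on S (\<lambda>x. u x * D x i + (G x \<bullet> i) * \<phi> x)"
      by (intro continuous_intros cu G continuous_on_subset[OF D(3)] continuous_on_subset[OF c\<phi>]) auto
    then have "continuous_on S (\<lambda>x. E x i)"
      by (rule continuous_on_eq) (simp add: E_def)
    moreover have "continuous_on (- K) (\<lambda>x. E x i)"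
      by (rule continuous_on_eq[OF continuous_on_const[of _ 0]]) (use K in \<open>auto simp: E_def\<close>)
    ultimately have "continuous_on (S \<union> - K) (\<lambda>x. E x i)"
      using S oK by (intro continuous_on_open_Un)
    moreover have "S \<union> - K = UNIV" using K(2) by auto
    ultimately show ?thesis by simp
  qed
  ultimately have "(LINT x|lborel. E x i) = 0"
    by (rule integral_directional_derivative_eq_0[OF _ _ K(1)]) (use K in \<open>auto simp: \<psi>_def\<close>)
  moreover have "(\<lambda>x. E x i) \<in> borel_measurable lborel"
    using \<open>continuous_on UNIV (\<lambda>x. E x i)\<close> by (simp add: borel_measurable_continuous_onI)
  ultimately have "(LINT x|lebesgue. E x i) = 0"
    by (simp add: integral_completion)
  moreover have "(LINT x|lebesgue. E x i) =
      (LINT x|lebesgue_on S. u x * D x i + (G x \<bullet> i) * \<phi> x)"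
    using S by (subst integral_lebesgue_on_eq_indicator)
      (auto simp: E_def indicator_def intro!: Bochner_Integration.integral_cong)
  moreover have "integrable (lebesgue_on S) (\<lambda>x. u x * D x i)"
    using lu K D(3) S unfolding locally_integrable_def
    by (intro integrable_mult_compact_support[where K = K]) auto
  moreover have "integrable (lebesgue_on S) (\<lambda>x. (G x \<bullet> i) * \<phi> x)"
    using locally_integrable_inner[OF lG] K c\<phi> S unfolding locally_integrable_def
    by (intro integrable_mult_compact_support[where K = K]) auto
  ultimately show "(LINT x|lebesgue_on S. u x * frechet_derivative \<phi> (at x) i) =
      - (LINT x|lebesgue_on S. (G x \<bullet> i) * \<phi> x)"
    unfolding D(2) by simp
qed

section \<open>Integration by parts up to the boundary\<close>

text \<open>The weights are nonnegative, have mass 1 and live on the interval from 1/(j+1) to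
  2/(j+1), which shrinks to 0. Continuity of \<open>A\<close> at 0 from the right is what identifies
  the limit.\<close>

lemma integral_approximate_identity_0:
  fixes A :: "real \<Rightarrow> real"
  assumes A: "continuous_on {0..b} A" and b: "b \<ge> 2"
    and st': "continuous_on UNIV st'" "\<And>x. (st has_real_derivative st' x) (at x)"
      "\<And>x. x \<le> 0 \<Longrightarrow> st x = 0" "\<And>x. 1 \<le> x \<Longrightarrow> st x = 1" "\<And>x. 0 \<le> st' x"
      "\<And>x. x \<le> 0 \<or> 1 \<le> x \<Longrightarrow> st' x = 0"
  shows "(\<lambda>j. integral {0..b} (\<lambda>y. A y * (real (Suc j) * st' (real (Suc j) * y - 1)))) \<longlonglongrightarrow> A 0"
proof (rule LIMSEQ_I)
  fix r :: real assume "r > 0"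
  define w where "w j y = real (Suc j) * st' (real (Suc j) * y - 1)" for j y
  have w0: "w j y \<ge> 0" for j y using st'(5) by (simp add: w_def)
  have cw: "continuous_on {0..b} (w j)" for j
    unfolding w_def by (intro continuous_intros continuous_on_compose2[OF st'(1)]) auto
  have wI: "(w j has_integral 1) {0..b}" for j
  proof -
    have "((\<lambda>y. st (real (Suc j) * y - 1)) has_real_derivative w j y) (at y)" for y
    proof -
      have "((\<lambda>y. real (Suc j) * y - 1) has_real_derivative real (Suc j)) (at y)"
        by (auto intro!: derivative_eq_intros)
      from DERIV_chain2[OF st'(2) this] show ?thesis
        unfolding w_def by (simp add: mult.commute)
    qed
    then have "((\<lambda>y. st (real (Suc j) * y - 1)) has_vector_derivative w j y) (at y within {0..b})" for y
      by (simp add: has_real_derivative_iff_has_vector_derivative has_vector_derivative_at_within)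
    then have "(w j has_integral (st (real (Suc j) * b - 1) - st (real (Suc j) * 0 - 1))) {0..b}"
      by (intro fundamental_theorem_of_calculus) (use b in auto)
    \<comment> \<open>The condition \<open>b \<ge> 2\<close> places the whole transition layer
      inside \<open>{0..b}\<close> already for \<open>j = 0\<close>.\<close>
    moreover have "1 \<le> real (Suc j) * b - 1"
      using mult_mono[of 1 "real (Suc j)" 2 b] b by simp
    ultimately show ?thesis using st'(3,4) by simp
  qed
  have "0 \<in> {0..b}" "r / 2 > 0" using b \<open>r > 0\<close> by auto
  then obtain d where "d > 0" "\<forall>y\<in>{0..b}. dist y 0 < d \<longrightarrow> dist (A y) (A 0) < r / 2"
    using A unfolding continuous_on_iff by blast
  then have d: "d > 0" "\<And>y. y \<in> {0..b} \<Longrightarrow> y < d \<Longrightarrow> \<bar>A y - A 0\<bar> \<le> r / 2"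
    by (auto simp: dist_real_def)
  obtain j0 :: nat where j0: "2 / d < real j0" using reals_Archimedean2 by blast
  show "\<exists>no. \<forall>n\<ge>no. norm (integral {0..b} (\<lambda>y. A y * (real (Suc n) * st' (real (Suc n) * y - 1))) - A 0) < r"
  proof (intro exI allI impI)
    fix j assume j: "j0 \<le> j"
    have i1: "(\<lambda>y. A y * w j y) integrable_on {0..b}"
      by (intro integrable_continuous_real continuous_intros A cw)
    have i2: "((\<lambda>y. A 0 * w j y) has_integral A 0 * 1) {0..b}"
      by (intro has_integral_mult_right wI)
    have i3: "((\<lambda>y. r / 2 * w j y) has_integral r / 2 * 1) {0..b}"
      by (intro has_integral_mult_right wI)
    have "integral {0..b} (\<lambda>y. A y * w j y) - A 0 = integral {0..b} (\<lambda>y. A y * w j y - A 0 * w j y)"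
      using has_integral_diff[OF integrable_integral[OF i1] i2, THEN integral_unique] by simp
    also have "norm \<dots> \<le> integral {0..b} (\<lambda>y. r / 2 * w j y)"
    proof (rule Henstock_Kurzweil_Integration.integral_norm_bound_integral)
      show "(\<lambda>y. A y * w j y - A 0 * w j y) integrable_on {0..b}"
        by (intro integrable_diff i1 has_integral_integrable[OF i2])
      show "(\<lambda>y. r / 2 * w j y) integrable_on {0..b}"
        by (rule has_integral_integrable[OF i3])
      fix y assume y: "y \<in> {0..b}"
      show "norm (A y * w j y - A 0 * w j y) \<le> r / 2 * w j y"
      proof (cases "y < d")
        case True
        then have "\<bar>A y - A 0\<bar> * w j y \<le> r / 2 * w j y"
          using d(2)[OF y] w0 by (intro mult_right_mono) auto
        then show ?thesis using w0[of j y] by (simp add: left_diff_distrib[symmetric] abs_mult)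
      next
        case False
        \<comment> \<open>At height \<open>d\<close> or more the argument of \<open>st'\<close>
          exceeds 1, beyond the support of the kernel.\<close>
        have "2 < real j0 * d" using j0 d(1) by (simp add: field_simps)
        also have "\<dots> \<le> real (Suc j) * y"
          using j False d(1) by (intro mult_mono) auto
        finally have "w j y = 0" using st'(6) by (simp add: w_def)
        then show ?thesis by simp
      qed
    qed
    also have "\<dots> = r / 2" using integral_unique[OF i3] by simp
    finally show "norm (integral {0..b} (\<lambda>y. A y * (real (Suc j) * st' (real (Suc j) * y - 1))) - A 0) < r"
      using \<open>r > 0\<close> unfolding w_def by simp
  qed
qed

lemma integrable_lebesgue_on_compact:
  fixes h :: "'a::euclidean_space \<Rightarrow> 'b::euclidean_space"
  assumes "compact K" "continuous_on K h"
  shows "integrable (lebesgue_on K) h"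
proof -
  have "h absolutely_integrable_on K"
    using locally_integrable_continuous[OF assms(2)] assms(1) by (simp add: locally_integrable_def)
  then show ?thesis
    using assms(1) by (simp add: set_integrable_def integrable_restrict_space compact_imp_closed)
qed

section \<open>The half-space and its boundary layer\<close>

lemma open_halfspace: "open (halfspace :: ((real^'n) \<times> real) set)"
proof -
  have eq: "(halfspace :: ((real^'n) \<times> real) set) = {z. 0 < snd z}"
    by (auto simp: halfspace_def)
  show ?thesis
    unfolding eq by (intro open_Collect_less continuous_intros)
qed

lemma closure_halfspace: "closure (halfspace :: ((real^'n) \<times> real) set) = {z. 0 \<le> snd z}"
proof -
  have eq: "halfspace = (UNIV :: (real^'n) set) \<times> {0::real<..}"
    by (auto simp: halfspace_def)
  show ?thesis
    unfolding eq closure_Times by auto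
qed

text \<open>On a box containing the relevant part of the support, Fubini reduces the statement to
  the slice integrals \<open>A y\<close>. These are continuous down to \<open>y = 0\<close>, and the
  one-dimensional kernel picks out \<open>A 0\<close>.\<close>

lemma boundary_layer_limit:
  fixes F :: "(real^'n) \<times> real \<Rightarrow> real"
  assumes F: "continuous_on (closure halfspace) F"
    and K: "compact K" "\<And>z. z \<notin> K \<Longrightarrow> F z = 0"
    and st': "continuous_on UNIV st'" "\<And>x. (st has_real_derivative st' x) (at x)"
      "\<And>x. x \<le> 0 \<Longrightarrow> st x = 0" "\<And>x. 1 \<le> x \<Longrightarrow> st x = 1" "\<And>x. 0 \<le> st' x"
      "\<And>x. x \<le> 0 \<or> 1 \<le> x \<Longrightarrow> st' x = 0"
  shows "(\<lambda>j. LINT z|lebesgue_on halfspace. F z * (real (Suc j) * st' (real (Suc j) * snd z - 1)))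
    \<longlonglongrightarrow> (LINT x|lebesgue. F (x, 0))"
proof -
  have bK: "bounded K" using K(1) by (rule compact_imp_bounded)
  obtain a :: "real^'n" where a: "fst ` K \<subseteq> cbox (- a) a"
    using bounded_subset_cbox_symmetric[OF bounded_fst[OF bK]] by blast
  obtain b :: real where b: "b \<ge> 2" "snd ` K \<subseteq> {..b}"
  proof -
    obtain c :: real where "snd ` K \<subseteq> cbox (- c) c"
      using bounded_subset_cbox_symmetric[OF bounded_snd[OF bK]] by blast
    then show thesis using that[of "max 2 c"] by force
  qed
  define Q where "Q = cbox (- a, 0) (a, b)"
  have Qeq: "Q = cbox (- a) a \<times> {0..b}" by (auto simp: Q_def cbox_Pair_eq)
  have FQ: "F z = 0" if "snd z \<ge> 0" "z \<notin> Q" for z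
    using that K(2)[of z] a b by (cases z) (force simp: Qeq)
  define G where "G j z = F z * (real (Suc j) * st' (real (Suc j) * snd z - 1))" for j z
  have cG: "continuous_on Q (G j)" for j
    unfolding G_def
    by (intro continuous_intros continuous_on_compose2[OF st'(1)] continuous_on_subset[OF F])
      (auto simp: Qeq closure_halfspace)
  define A where "A y = integral (cbox (- a) a) (\<lambda>x. F (x, y))" for y
  have Acont: "continuous_on {0..b} A"
    unfolding A_def
  proof (rule integral_continuous_on_param)
    show "continuous_on ({0..b} \<times> cbox (- a) a) (\<lambda>(y, x). F (x, y))"
      unfolding case_prod_unfold
      by (rule continuous_on_compose2[OF F]) (auto simp: closure_halfspace intro!: continuous_intros)
  qed
  have "(LINT z|lebesgue_on halfspace. G j z) =
      integral {0..b} (\<lambda>y. A y * (real (Suc j) * st' (real (Suc j) * y - 1)))" for j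
  proof -
    have "(LINT z|lebesgue_on halfspace. G j z) = (LINT z|lebesgue. indicator halfspace z *\<^sub>R G j z)"
      by (rule integral_lebesgue_on_eq_indicator) (simp add: open_halfspace)
    also have "\<dots> = (LINT z|lebesgue. indicator Q z *\<^sub>R G j z)"
    proof (rule Bochner_Integration.integral_cong)
      fix z :: "(real^'n) \<times> real"
      \<comment> \<open>The box contains its bottom face while the half-space does not; on that face
        the kernel vanishes because \<open>st'\<close> is evaluated at -1.\<close>
      consider "snd z < 0" | "snd z = 0" | "snd z > 0" "z \<in> Q" | "snd z > 0" "z \<notin> Q"
        using linorder_less_linear[of "snd z" 0] by blast
      then show "indicator halfspace z *\<^sub>R G j z = indicator Q z *\<^sub>R G j z"
      proof cases
        case 2
        then have "G j z = 0" using st'(6) by (simp add: G_def)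
        then show ?thesis by simp
      next
        case 4
        then show ?thesis using FQ[of z] by (simp add: G_def)
      qed (auto simp: halfspace_def Qeq indicator_def split: prod.splits)
    qed simp
    also have "\<dots> = (LINT z|lebesgue_on Q. G j z)"
      by (rule integral_lebesgue_on_eq_indicator[symmetric]) (simp add: Q_def)
    also have "\<dots> = integral Q (G j)"
      by (intro lebesgue_integral_eq_integral integrable_lebesgue_on_compact cG) (auto simp: Q_def)
    also have "\<dots> = integral (cbox (- a) a) (\<lambda>x. integral (cbox 0 b) (\<lambda>y. G j (x, y)))"
      using cG[of j] unfolding Q_def by (rule integral_prod_continuous)
    also have "\<dots> = integral (cbox 0 b) (\<lambda>y. integral (cbox (- a) a) (\<lambda>x. G j (x, y)))"
      using cG[of j] unfolding Q_def
      by (intro integral_swap_continuous) (simp add: case_prod_unfold)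
    also have "\<dots> = integral {0..b} (\<lambda>y. A y * (real (Suc j) * st' (real (Suc j) * y - 1)))"
      by (simp add: G_def A_def)
    finally show ?thesis .
  qed
  moreover have "A 0 = (LINT x|lebesgue. F (x, 0))"
  proof -
    have "(LINT x|lebesgue. F (x, 0)) = (LINT x|lebesgue. indicator (cbox (- a) a) x *\<^sub>R F (x, 0))"
      using FQ[of "(_, 0)"] b by (intro Bochner_Integration.integral_cong) (auto simp: Qeq indicator_def)
    also have "\<dots> = (LINT x|lebesgue_on (cbox (- a) a). F (x, 0))"
      by (rule integral_lebesgue_on_eq_indicator[symmetric]) simp
    also have "\<dots> = A 0"
      unfolding A_def
      by (intro lebesgue_integral_eq_integral integrable_lebesgue_on_compact
          continuous_on_compose2[OF F]) (auto intro!: continuous_intros simp: closure_halfspace)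
    finally show ?thesis by simp
  qed
  ultimately show ?thesis
    using integral_approximate_identity_0[OF Acont b(1) st'] unfolding G_def by simp
qed

section \<open>Compactly supported radial fields and the boundary term\<close>

lemma Lp_space_continuous_compact_support:
  fixes h :: "'a::euclidean_space \<Rightarrow> 'b::euclidean_space"
  assumes h: "continuous_on UNIV h" and K: "compact K" "\<And>x. x \<notin> K \<Longrightarrow> h x = 0"
    and S: "S \<in> sets lebesgue" and q: "q > 0"
  shows "h \<in> Lp_space S q"
proof -
  have m: "h \<in> borel_measurable lebesgue"
    using h by (simp add: borel_measurable_continuous_onI measurable_completion)
  have c: "continuous_on UNIV (\<lambda>x. norm (h x) powr q)"
    using q by (intro continuous_on_powr' continuous_intros h) auto
  have "integrable lborel (\<lambda>x. indicator K x *\<^sub>R norm (h x) powr q)"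
    by (intro borel_integrable_compact K(1) continuous_on_subset[OF c]) auto
  moreover have "(\<lambda>x. indicator K x *\<^sub>R norm (h x) powr q) = (\<lambda>x. norm (h x) powr q)"
    using K(2) q by (auto simp: indicator_def fun_eq_iff)
  ultimately have "integrable lebesgue (\<lambda>x. norm (h x) powr q)"
    using c by (simp add: integrable_completion borel_measurable_continuous_onI)
  then have "integrable (lebesgue_on S) (\<lambda>x. norm (h x) powr q)"
    using S by (simp add: integrable_restrict_space integrable_mult_indicator[where 'b = real, simplified])
  then show ?thesis
    using m unfolding Lp_space_def by (auto intro: measurable_restrict_space1)
qed

text \<open>Turns vanishing of \<open>k\<close> beyond \<open>M\<close> into compact support of the
  corresponding radial function of \<open>z\<close>.\<close>

lemma outside_cball_norm_add_square:
  fixes z :: "'a::real_normed_vector"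
  assumes "z \<notin> cball (- e) (sqrt M)"
  shows "M \<le> (norm (z + e))\<^sup>2"
proof -
  have "sqrt M < norm (z + e)"
    using assms by (simp add: dist_norm norm_minus_commute[of "- e" z])
  then have "sqrt M < sqrt ((norm (z + e))\<^sup>2)" by simp
  then show ?thesis unfolding real_sqrt_less_iff by simp
qed

text \<open>The field \<open>k (\<bar>z + e\<bar>\<^sup>2) (z + e)\<close> does not vanish on the boundary, so it is multiplied by
  cutoffs in \<open>y\<close> that rise from 0 to 1 on \<open>[1/j, 2/j]\<close>; their \<open>y\<close>-derivatives concentrate on the
  boundary as \<open>j \<rightarrow> \<infinity>\<close> and produce the boundary term.\<close>

lemma radial_field_integration_by_parts:
  fixes U :: "(real^'n) \<times> real \<Rightarrow> real" and g :: "(real^'n) \<times> real \<Rightarrow> (real^'n) \<times> real"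
  defines "e \<equiv> (0, 1) :: (real^'n) \<times> real"
  assumes k: "smooth_real k" "continuous_on UNIV k'" "\<And>x. (k has_real_derivative k' x) (at x)"
      "\<And>s. s \<ge> M \<Longrightarrow> k s = 0" "\<And>s. s \<ge> M \<Longrightarrow> k' s = 0"
    and U: "continuous_on (closure halfspace) U" and g: "is_weak_gradient halfspace U g"
    and p: "1 < p" and gp: "g \<in> Lp_space halfspace p"
  shows "(LINT z|lebesgue_on halfspace. U z * (real (CARD('n) + 1) * k ((norm (z + e))\<^sup>2) +
            2 * (norm (z + e))\<^sup>2 * k' ((norm (z + e))\<^sup>2))) +
      (LINT z|lebesgue_on halfspace. g z \<bullet> (k ((norm (z + e))\<^sup>2) *\<^sub>R (z + e))) =
      - (LINT x|lebesgue. U (x, 0) * k (1 + (norm x)\<^sup>2))"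
proof -
  let ?H = "halfspace :: ((real^'n) \<times> real) set"
  let ?s = "\<lambda>z :: (real^'n) \<times> real. (norm (z + e))\<^sup>2"
  have H: "?H \<in> sets lebesgue" by (simp add: open_halfspace)
  obtain st st' where st: "smooth_real st" "smooth_real st'"
      "\<And>x. (st has_real_derivative st' x) (at x)"
      "\<And>x. x \<le> 0 \<Longrightarrow> st x = 0" "\<And>x. 1 \<le> x \<Longrightarrow> st x = 1" "\<And>x. 0 \<le> st' x"
      "\<And>x. x \<le> 0 \<or> 1 \<le> x \<Longrightarrow> st' x = 0"
    using smooth_step_exists by metis
  have cst: "continuous_on S st" "continuous_on S st'" for S
    using st(1,2) by (auto intro: smooth_real_continuous)
  have ck: "continuous_on UNIV k" using k(1) by (rule smooth_real_continuous)
  have st_mono: "st x \<le> st y" if "x \<le> y" for x y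
    using DERIV_nonneg_imp_nondecreasing[OF that] st(3,6) by blast
  have st01: "0 \<le> st x" "st x \<le> 1" for x
    using st_mono[of "min x 0" x] st_mono[of x "max x 1"] st(4)[of "min x 0"] st(5)[of "max x 1"]
    by auto
  define K where "K = cball (- e) (sqrt M)"
  have K: "compact K" by (simp add: K_def)
  have outK: "?s z \<ge> M" if "z \<notin> K" for z
    using that unfolding K_def by (rule outside_cball_norm_add_square)
  define \<eta> where "\<eta> j z = st (real (Suc j) * snd z - 1)" for j :: nat and z :: "(real^'n) \<times> real"
  define \<eta>' where "\<eta>' j z = real (Suc j) * st' (real (Suc j) * snd z - 1)" for j :: nat and z :: "(real^'n) \<times> real"
  \<comment> \<open>Each partial derivative is tested with its own component of the cut-off field.
    Summation over \<open>Basis\<close> then produces a divergence next to \<open>U\<close> and an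
    inner product with \<open>g\<close>. The function \<open>D\<close> is the product-rule
    derivative of \<open>\<phi>\<close>.\<close>
  define \<phi> where "\<phi> j i z = ((z + e) \<bullet> i) * (k (?s z) * \<eta> j z)" for j i and z :: "(real^'n) \<times> real"
  define D where "D j i z v = ((z + e) \<bullet> i) * (k (?s z) * (\<eta>' j z * snd v) +
      (k' (?s z) * (2 * ((z + e) \<bullet> v))) * \<eta> j z) + (v \<bullet> i) * (k (?s z) * \<eta> j z)"
    for j i and z v :: "(real^'n) \<times> real"
  have \<phi>_test: "\<phi> j i \<in> test_functions ?H" for j i
  proof (rule test_functionsI)
    have "(\<lambda>z. k (?s z)) \<in> smooth_fun"
      by (rule smooth_fun.comp[OF k(1) smooth_fun_norm_square])
    moreover have "\<eta> j \<in> smooth_fun"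
    proof -
      have "(\<lambda>z::(real^'n) \<times> real. z \<bullet> (0, real (Suc j)) + - 1) \<in> smooth_fun"
        by (intro smooth_fun.add smooth_fun.inner smooth_fun.const)
      from smooth_fun.comp[OF st(1) this] show ?thesis
        by (simp add: \<eta>_def[abs_def] inner_prod_def mult.commute)
    qed
    moreover have "(\<lambda>z. (z + e) \<bullet> i) \<in> smooth_fun"
      unfolding inner_add_left by (intro smooth_fun.add smooth_fun.inner smooth_fun.const)
    ultimately show "\<phi> j i \<in> smooth_fun"
      unfolding \<phi>_def by (intro smooth_fun.mult)
    \<comment> \<open>The shift by 1 in \<open>\<eta>\<close> makes it vanish on a strip of positive
      height, so the support stays away from the boundary and is compact in the open
      half-space.\<close>
    let ?K = "K \<inter> {z. 1 / real (Suc j) \<le> snd z}"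
    show "compact ?K"
      by (intro compact_Int_closed K closed_Collect_le continuous_intros)
    have "0 < snd z" if "1 / real (Suc j) \<le> snd z" for z :: "(real^'n) \<times> real"
      using that by (rule order_less_le_trans[rotated]) simp
    then show "?K \<subseteq> ?H"
      by (auto simp: halfspace_def)
    show "\<phi> j i z = 0" if z: "z \<notin> ?K" for z
    proof (cases "z \<in> K")
      case False
      then show ?thesis using k(4)[OF outK] by (simp add: \<phi>_def)
    next
      case True
      then have "snd z < 1 / real (Suc j)" using z by simp
      then have "real (Suc j) * snd z - 1 \<le> 0" by (simp add: field_simps)
      then show ?thesis using st(4) by (simp add: \<phi>_def \<eta>_def)
    qed
  qed
  have \<phi>_deriv: "(\<phi> j i has_derivative D j i z) (at z)" for j i z
  proof -
    have "((\<lambda>z. (z + e) \<bullet> i) has_derivative (\<lambda>v. v \<bullet> i)) (at z)"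
      by (auto intro!: derivative_eq_intros)
    moreover have "((\<lambda>z. k (?s z)) has_derivative (\<lambda>v. k' (?s z) * (2 * ((z + e) \<bullet> v)))) (at z)"
    proof -
      have "((\<lambda>z. (z + e) \<bullet> (z + e)) has_derivative (\<lambda>v. 2 * ((z + e) \<bullet> v))) (at z)"
        by (auto intro!: derivative_eq_intros simp: inner_commute)
      then have "(?s has_derivative (\<lambda>v. 2 * ((z + e) \<bullet> v))) (at z)"
        by (simp add: power2_norm_eq_inner)
      from has_derivative_compose[OF this k(3)[unfolded has_field_derivative_def]]
      show ?thesis .
    qed
    moreover have "(\<eta> j has_derivative (\<lambda>v. \<eta>' j z * snd v)) (at z)"
    proof -
      have "((\<lambda>z. real (Suc j) * snd z - 1) has_derivative (\<lambda>v. real (Suc j) * snd v)) (at z)"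
        by (auto intro!: derivative_eq_intros)
      from has_derivative_compose[OF this st(3)[unfolded has_field_derivative_def]]
      show ?thesis by (simp add: \<eta>_def[abs_def] \<eta>'_def algebra_simps)
    qed
    ultimately show ?thesis
      unfolding \<phi>_def D_def by (intro has_derivative_mult)
  qed
  have c\<eta>: "continuous_on S (\<eta> j)" "continuous_on S (\<eta>' j)" for S j
    unfolding \<eta>_def \<eta>'_def
    by (intro continuous_intros continuous_on_compose2[OF cst(1)[of UNIV]]
        continuous_on_compose2[OF cst(2)[of UNIV]]; simp)+
  have cs: "continuous_on S (\<lambda>z. k (?s z))" "continuous_on S (\<lambda>z. k' (?s z))" for S
    by (intro continuous_on_compose2[OF ck] continuous_on_compose2[OF k(2)] continuous_intros; simp)+
  define X where "X z = k (?s z) *\<^sub>R (z + e)" for z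
  have X: "X \<in> Lp_space ?H r" if "r > 0" for r
    unfolding X_def
    by (intro Lp_space_continuous_compact_support[OF _ K] continuous_intros cs H that)
      (use k(4) outK in auto)
  define Q where "Q z = real (CARD('n) + 1) * k (?s z) + 2 * ?s z * k' (?s z)" for z
  have cQ: "continuous_on S Q" for S
    unfolding Q_def by (intro continuous_intros cs)
  have Q0: "Q z = 0" if "z \<notin> K" for z
    using k(4,5)[OF outK[OF that]] by (simp add: Q_def)
  \<comment> \<open>Here \<open>Q\<close> is the divergence of the uncut field \<open>X\<close>; the
    second term is the derivative of the cutoff, and its factor \<open>1 + snd z\<close> is the last
    coordinate of \<open>z + e\<close>.\<close>
  have sumD: "(\<Sum>i\<in>Basis. D j i z i) = Q z * \<eta> j z + (1 + snd z) * k (?s z) * \<eta>' j z" for j z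
  proof -
    have "(\<Sum>i\<in>Basis. D j i z i) = (\<Sum>i\<in>Basis. ((z + e) \<bullet> i) * (i \<bullet> (0, 1))) * (k (?s z) * \<eta>' j z) +
        (\<Sum>i\<in>Basis. ((z + e) \<bullet> i) * ((z + e) \<bullet> i)) * (2 * k' (?s z) * \<eta> j z) +
        (\<Sum>i\<in>(Basis :: ((real^'n) \<times> real) set). i \<bullet> i) * (k (?s z) * \<eta> j z)"
      unfolding D_def sum_distrib_right sum.distrib[symmetric]
      by (intro sum.cong refl) (simp add: inner_prod_def algebra_simps)
    also have "(\<Sum>i\<in>Basis. ((z + e) \<bullet> i) * (i \<bullet> (0, 1))) = (z + e) \<bullet> (0, 1)"
      by (simp add: euclidean_inner[of "z + e" "(0, 1)"] inner_commute)
    also have "\<dots> = 1 + snd z" by (simp add: inner_prod_def e_def)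
    also have "(\<Sum>i\<in>Basis. ((z + e) \<bullet> i) * ((z + e) \<bullet> i)) = ?s z"
      unfolding power2_norm_eq_inner by (rule euclidean_inner[symmetric])
    also have "(\<Sum>i\<in>(Basis :: ((real^'n) \<times> real) set). i \<bullet> i) = real (CARD('n) + 1)"
      by (simp add: inner_same_Basis)
    finally show ?thesis by (simp add: Q_def algebra_simps)
  qed
  have lU: "locally_integrable ?H U" and lg: "locally_integrable ?H g"
    using g by (auto simp: is_weak_gradient_def)
  \<comment> \<open>Local integrability on the open half-space does not reach the boundary.
    Continuity of \<open>U\<close> on the closure does, since \<open>K\<close> meets the closure in
    a compact set.\<close>
  have integrable_supp: "integrable (lebesgue_on ?H) (\<lambda>z. U z * h z)"
    if h: "continuous_on (closure ?H) h" "\<And>z. z \<notin> K \<Longrightarrow> h z = 0" for h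
  proof -
    have "(\<lambda>z. U z * h z) absolutely_integrable_on (K \<inter> closure ?H)"
      using locally_integrable_continuous[OF continuous_on_mult[OF U h(1)]] K
      unfolding locally_integrable_def by (auto intro: compact_Int_closed)
    then have "(\<lambda>z. U z * h z) absolutely_integrable_on (K \<inter> ?H)"
      by (rule set_integrable_subset) (use K H closure_subset in \<open>auto simp: compact_imp_closed\<close>)
    moreover have "(\<lambda>z. indicator (K \<inter> ?H) z *\<^sub>R (U z * h z)) = (\<lambda>z. indicator ?H z *\<^sub>R (U z * h z))"
      using h(2) by (auto simp: indicator_def fun_eq_iff)
    ultimately show ?thesis
      using H by (simp add: set_integrable_def integrable_restrict_space)
  qed
  have iUQ: "integrable (lebesgue_on ?H) (\<lambda>z. U z * Q z)"
    by (rule integrable_supp[OF cQ Q0])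
  have bounded_integrable: "integrable (lebesgue_on ?H) (\<lambda>z. U z * Q z * \<eta> j z)" for j
    unfolding mult.assoc by (rule integrable_supp) (auto intro!: continuous_intros cQ c\<eta> simp: Q0)
  have boundary_integrable:
    "integrable (lebesgue_on ?H) (\<lambda>z. U z * ((1 + snd z) * k (?s z)) * \<eta>' j z)" for j
    unfolding mult.assoc by (rule integrable_supp)
      (auto intro!: continuous_intros cs c\<eta> simp: k(4)[OF outK])
  have eq: "(LINT z|lebesgue_on ?H. U z * Q z * \<eta> j z) +
      (LINT z|lebesgue_on ?H. U z * ((1 + snd z) * k (?s z)) * \<eta>' j z) =
      - (LINT z|lebesgue_on ?H. (g z \<bullet> X z) * \<eta> j z)" for j
  proof -
    have ints: "integrable (lebesgue_on ?H) (\<lambda>z. U z * D j i z i)"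
      "integrable (lebesgue_on ?H) (\<lambda>z. (g z \<bullet> i) * \<phi> j i z)"
      "(LINT z|lebesgue_on ?H. U z * D j i z i) = - (LINT z|lebesgue_on ?H. (g z \<bullet> i) * \<phi> j i z)"
      if i: "i \<in> Basis" for i
    proof -
      have fr: "frechet_derivative (\<phi> j i) (at z) = D j i z" for z
        using frechet_derivative_at[OF \<phi>_deriv] by simp
      obtain D' L where L: "compact L" "L \<subseteq> ?H" "\<And>x. x \<notin> L \<Longrightarrow> \<phi> j i x = 0"
        "\<And>x v. x \<notin> L \<Longrightarrow> D' x v = 0" "\<And>x. frechet_derivative (\<phi> j i) (at x) = D' x"
        "\<And>i. i \<in> Basis \<Longrightarrow> continuous_on UNIV (\<lambda>x. D' x i)" "continuous_on UNIV (\<phi> j i)"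
        by (rule test_functionsE[OF \<phi>_test[of j i]]) blast
      have D': "D' = D j i" using L(5) fr by auto
      show "integrable (lebesgue_on ?H) (\<lambda>z. U z * D j i z i)"
        using lU L i unfolding locally_integrable_def D'
        by (intro integrable_mult_compact_support[where K = L] H) auto
      show "integrable (lebesgue_on ?H) (\<lambda>z. (g z \<bullet> i) * \<phi> j i z)"
        using locally_integrable_inner[OF lg, of i] L unfolding locally_integrable_def
        by (intro integrable_mult_compact_support[where K = L] H) auto
      show "(LINT z|lebesgue_on ?H. U z * D j i z i) = - (LINT z|lebesgue_on ?H. (g z \<bullet> i) * \<phi> j i z)"
        using g \<phi>_test[of j i] i unfolding is_weak_gradient_def fr[symmetric] by blast
    qed
    have i2: "integrable (lebesgue_on ?H) (\<lambda>z. U z * ((1 + snd z) * k (?s z)) * \<eta>' j z)"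
      by (rule boundary_integrable)
    have "(LINT z|lebesgue_on ?H. U z * Q z * \<eta> j z) +
        (LINT z|lebesgue_on ?H. U z * ((1 + snd z) * k (?s z)) * \<eta>' j z) =
        (LINT z|lebesgue_on ?H. U z * Q z * \<eta> j z + U z * ((1 + snd z) * k (?s z)) * \<eta>' j z)"
      by (intro Bochner_Integration.integral_add[symmetric] i2 bounded_integrable iUQ)
    also have "\<dots> = (LINT z|lebesgue_on ?H. (\<Sum>i\<in>Basis. U z * D j i z i))"
      unfolding sum_distrib_left[symmetric] sumD by (simp add: algebra_simps)
    also have "\<dots> = (\<Sum>i\<in>Basis. (LINT z|lebesgue_on ?H. U z * D j i z i))"
      using ints(1) by (rule Bochner_Integration.integral_sum)
    also have "\<dots> = - (\<Sum>i\<in>Basis. (LINT z|lebesgue_on ?H. (g z \<bullet> i) * \<phi> j i z))"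
      unfolding sum_negf[symmetric] using ints(3) by (rule sum.cong[OF refl])
    also have "(\<Sum>i\<in>Basis. (LINT z|lebesgue_on ?H. (g z \<bullet> i) * \<phi> j i z)) =
        (LINT z|lebesgue_on ?H. (\<Sum>i\<in>Basis. (g z \<bullet> i) * \<phi> j i z))"
      using ints(2) by (rule Bochner_Integration.integral_sum[symmetric])
    also have "(\<lambda>z. \<Sum>i\<in>Basis. (g z \<bullet> i) * \<phi> j i z) = (\<lambda>z. (g z \<bullet> X z) * \<eta> j z)"
    proof
      fix z
      have "g z \<bullet> X z = k (?s z) * (\<Sum>i\<in>Basis. (g z \<bullet> i) * ((z + e) \<bullet> i))"
        by (simp add: X_def euclidean_inner[of "g z" "z + e"])
      then show "(\<Sum>i\<in>Basis. (g z \<bullet> i) * \<phi> j i z) = (g z \<bullet> X z) * \<eta> j z"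
        by (simp add: \<phi>_def sum_distrib_left sum_distrib_right algebra_simps)
    qed
    finally show ?thesis .
  qed
  \<comment> \<open>The gradient need not be continuous at the boundary; its integrability there
    comes from L^p membership and Hoelder's inequality.\<close>
  have igX: "integrable (lebesgue_on ?H) (\<lambda>z. g z \<bullet> X z)"
    using Hoelder_inner(1)[of p "p / (p - 1)", OF p _ _ gp X] p by (simp add: field_simps)
  have cutoff: "(\<lambda>j. LINT z|lebesgue_on ?H. h z * \<eta> j z) \<longlonglongrightarrow> (LINT z|lebesgue_on ?H. h z)"
    if h: "integrable (lebesgue_on ?H) h" for h
  proof (rule integral_dominated_convergence[where w = "\<lambda>z. norm (h z)"])
    show "(\<lambda>z. h z * \<eta> j z) \<in> borel_measurable (lebesgue_on ?H)" for j
    proof -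
      have "\<eta> j \<in> borel_measurable lebesgue"
        using c\<eta>(1)[of UNIV j] by (simp add: borel_measurable_continuous_onI measurable_completion)
      then show ?thesis
        by (intro borel_measurable_times borel_measurable_integrable[OF h] measurable_restrict_space1)
    qed
    show "AE z in lebesgue_on ?H. (\<lambda>j. h z * \<eta> j z) \<longlonglongrightarrow> h z"
    proof (rule AE_I2)
      fix z assume "z \<in> space (lebesgue_on ?H)"
      then have z: "snd z > 0" by (auto simp: space_restrict_space halfspace_def)
      obtain j0 :: nat where j0: "2 / snd z < real j0" using reals_Archimedean2 by blast
      have "\<eta> j z = 1" if "j \<ge> j0" for j
      proof -
        have "2 < real j0 * snd z" using j0 z by (simp add: field_simps)
        also have "\<dots> \<le> real (Suc j) * snd z" using that z by (intro mult_right_mono) auto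
        finally show ?thesis using st(5) by (simp add: \<eta>_def)
      qed
      then have "eventually (\<lambda>j. h z * \<eta> j z = h z) sequentially"
        by (intro eventually_sequentiallyI[of j0]) simp
      then show "(\<lambda>j. h z * \<eta> j z) \<longlonglongrightarrow> h z" by (rule tendsto_eventually)
    qed
    show "AE z in lebesgue_on ?H. norm (h z * \<eta> j z) \<le> norm (h z)" for j
      using st01 by (intro AE_I2) (auto simp: abs_mult \<eta>_def intro!: mult_left_le)
  qed (use h in auto)
  \<comment> \<open>On the boundary \<open>1 + snd z\<close> equals 1 and |z + e|^2 equals 1 +
    |x|^2, which gives the boundary integrand.\<close>
  have "(\<lambda>j. LINT z|lebesgue_on ?H. U z * ((1 + snd z) * k (?s z)) * \<eta>' j z) \<longlonglongrightarrow>
      (LINT x|lebesgue. U (x, 0) * k (1 + (norm x)\<^sup>2))"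
  proof -
    have "continuous_on (closure ?H) (\<lambda>z. U z * ((1 + snd z) * k (?s z)))"
      by (intro continuous_intros U cs)
    moreover have "U z * ((1 + snd z) * k (?s z)) = 0" if "z \<notin> K" for z
      using k(4)[OF outK[OF that]] by simp
    ultimately have "(\<lambda>j. LINT z|lebesgue_on ?H. U z * ((1 + snd z) * k (?s z)) * \<eta>' j z) \<longlonglongrightarrow>
      (LINT x|lebesgue. U (x, 0) * ((1 + snd (x, 0 :: real)) * k (?s (x, 0))))"
      unfolding \<eta>'_def by (rule boundary_layer_limit[OF _ K _ cst(2) st(3-7)])
    moreover have "?s (x, 0) = 1 + (norm x)\<^sup>2" for x
      by (simp add: e_def norm_Pair)
    ultimately show ?thesis by simp
  qed
  then have "(\<lambda>j. (LINT z|lebesgue_on ?H. U z * Q z * \<eta> j z) +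
      (LINT z|lebesgue_on ?H. U z * ((1 + snd z) * k (?s z)) * \<eta>' j z)) \<longlonglongrightarrow>
      (LINT z|lebesgue_on ?H. U z * Q z) + (LINT x|lebesgue. U (x, 0) * k (1 + (norm x)\<^sup>2))"
    by (intro tendsto_add cutoff iUQ)
  moreover have "(\<lambda>j. - (LINT z|lebesgue_on ?H. (g z \<bullet> X z) * \<eta> j z)) \<longlonglongrightarrow>
      - (LINT z|lebesgue_on ?H. g z \<bullet> X z)"
    by (intro tendsto_minus cutoff igX)
  ultimately have "(LINT z|lebesgue_on ?H. U z * Q z) + (LINT x|lebesgue. U (x, 0) * k (1 + (norm x)\<^sup>2)) =
      - (LINT z|lebesgue_on ?H. g z \<bullet> X z)"
    unfolding eq by (rule LIMSEQ_unique)
  then show ?thesis by (simp add: Q_def X_def)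
qed

section \<open>Decay in the half-space and truncation of the flux field\<close>

text \<open>Measurability survives a change on a null set because Lebesgue measure is
  complete.\<close>

lemma Lp_space_AE_cong:
  fixes f g :: "'a::euclidean_space \<Rightarrow> 'b::euclidean_space"
  assumes S: "S \<in> sets lebesgue" and g: "g \<in> Lp_space S r"
    and ae: "AE x in lebesgue_on S. g x = f x"
  shows "f \<in> Lp_space S r"
proof -
  have gm: "g \<in> borel_measurable (lebesgue_on S)" and gi: "integrable (lebesgue_on S) (\<lambda>x. norm (g x) powr r)"
    using g by (auto simp: Lp_space_def)
  have ae': "AE x in lebesgue. indicator S x *\<^sub>R g x = indicator S x *\<^sub>R f x"
    using ae S by (subst (asm) AE_restrict_space_iff) (auto elim!: AE_mp simp: indicator_def)
  have "(\<lambda>x. indicator S x *\<^sub>R g x) \<in> borel_measurable lebesgue"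
    using gm S by (simp add: borel_measurable_restrict_space_iff)
  then have "(\<lambda>x. indicator S x *\<^sub>R f x) \<in> borel_measurable lebesgue"
    using ae' by (rule borel_measurable_AE)
  then have fm: "f \<in> borel_measurable (lebesgue_on S)"
    using S by (simp add: borel_measurable_restrict_space_iff)
  have "integrable (lebesgue_on S) (\<lambda>x. norm (f x) powr r)"
    using gi gm fm ae by (subst integrable_cong_AE[of _ _ "\<lambda>x. norm (g x) powr r"]) (auto elim!: AE_mp)
  with fm show ?thesis by (simp add: Lp_space_def)
qed

lemma hom_sobolev_weak_gradient:
  assumes S: "open S" and u: "u \<in> hom_sobolev S p"
  shows "is_weak_gradient S u (weak_gradient S u)" "weak_gradient S u \<in> Lp_space S p"
proof -
  obtain g where g: "g \<in> Lp_space S p" "is_weak_gradient S u g"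
    using u by (auto simp: hom_sobolev_def)
  show "is_weak_gradient S u (weak_gradient S u)"
    using someI[of "is_weak_gradient S u", OF g(2)] by (simp add: weak_gradient_def)
  have "AE x in lebesgue_on S. g x = weak_gradient S u x"
    using weak_gradient_AE_eq[OF S g(2)] by (rule AE_mp) simp
  moreover have "S \<in> sets lebesgue" using S by simp
  ultimately show "weak_gradient S u \<in> Lp_space S p"
    using Lp_space_AE_cong[OF _ g(1)] by blast
qed

lemma conjugate_exponent:
  fixes p :: real
  assumes "1 < p"
  shows "1 < p / (p - 1)" "1 / p + 1 / (p / (p - 1)) = 1"
  using assms by (simp_all add: less_divide_eq diff_divide_distrib add_divide_distrib[symmetric])

text \<open>The shift keeps \<open>z + e\<close> away from the singularity at the origin. The
  constant 3 arises from 1 + |z| <= |z + e| + 2 together with |z + e| > 1.\<close>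

lemma halfspace_norm_add:
  fixes z :: "(real^'n) \<times> real"
  assumes "z \<in> halfspace"
  shows "1 < norm (z + (0, 1))" "1 + norm z \<le> 3 * norm (z + (0, 1))"
proof -
  have "1 < \<bar>snd (z + (0, 1))\<bar>" using assms by (auto simp: halfspace_def)
  also have "\<dots> \<le> norm (z + (0, 1))"
    using norm_snd_le[of "snd (z + (0, 1))" "fst (z + (0, 1))"] unfolding prod.collapse real_norm_def .
  finally show 1: "1 < norm (z + (0, 1))" .
  have "norm z \<le> norm (z + (0, 1)) + norm ((0, 1) :: (real^'n) \<times> real)"
    using norm_triangle_ineq4[of "z + (0, 1)" "(0, 1)"] by simp
  also have "norm ((0, 1) :: (real^'n) \<times> real) = 1" by (simp add: norm_Pair)
  finally show "1 + norm z \<le> 3 * norm (z + (0, 1))" using 1 by simp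
qed

text \<open>Since |z + e| dominates a multiple of 1 + |z|, integrability of \<open>f\<close>, its
  gradient and the flux fields is reduced to one inequality between the decay exponent and the
  dimension n + 1.\<close>

lemma Lp_space_halfspace_decay:
  fixes h :: "(real^'n) \<times> real \<Rightarrow> 'b::euclidean_space"
  assumes h: "h \<in> borel_measurable borel" and r: "0 < r" "real CARD('n) + 1 < b * r"
    and le: "\<And>z. z \<in> halfspace \<Longrightarrow> norm (h z) \<le> C * norm (z + (0, 1)) powr (- b)" and C: "0 \<le> C"
  shows "h \<in> Lp_space halfspace r"
proof -
  have m: "h \<in> borel_measurable (lebesgue_on halfspace)"
    using h by (intro measurable_restrict_space1 measurable_completion) simp
  have DIM: "DIM((real^'n) \<times> real) = CARD('n) + 1" by simp
  have "integrable lborel (\<lambda>z :: (real^'n) \<times> real. (1 + norm z) powr (- (b * r)))"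
    by (rule integrable_one_plus_norm_powr) (use r in \<open>simp add: DIM\<close>)
  then have "integrable lebesgue (\<lambda>z :: (real^'n) \<times> real. (1 + norm z) powr (- (b * r)))"
    by (subst integrable_completion) auto
  then have i: "integrable (lebesgue_on halfspace) (\<lambda>z :: (real^'n) \<times> real. (1 + norm z) powr (- (b * r)))"
    by (subst integrable_restrict_space)
      (auto simp: open_halfspace intro: integrable_mult_indicator[where 'b = real, simplified])
  have b: "b > 0" using r by (smt (verit) mult_nonpos_nonneg of_nat_0_le_iff)
  have "integrable (lebesgue_on halfspace) (\<lambda>z. norm (h z) powr r)"
  proof (rule Bochner_Integration.integrable_bound)
    show "integrable (lebesgue_on halfspace)
        (\<lambda>z :: (real^'n) \<times> real. C powr r * (3 powr (b * r) * (1 + norm z) powr (- (b * r))))"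
      by (intro integrable_mult_right i)
    show "(\<lambda>z. norm (h z) powr r) \<in> borel_measurable (lebesgue_on halfspace)"
      using m by measurable
    show "AE z in lebesgue_on halfspace. norm (norm (h z) powr r) \<le>
        norm (C powr r * (3 powr (b * r) * (1 + norm z) powr (- (b * r))))"
    proof (rule AE_I2)
      fix z :: "(real^'n) \<times> real" assume "z \<in> space (lebesgue_on halfspace)"
      then have z: "z \<in> halfspace" by (simp add: space_restrict_space)
      have "norm (h z) powr r \<le> (C * norm (z + (0, 1)) powr (- b)) powr r"
        using le[OF z] r by (intro powr_mono2) auto
      also have "\<dots> = C powr r * norm (z + (0, 1)) powr (- (b * r))"
        using C by (simp add: powr_mult powr_powr)
      also have "norm (z + (0, 1)) powr (- (b * r)) \<le> ((1 + norm z) / 3) powr (- (b * r))"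
        using halfspace_norm_add(2)[OF z] b r by (intro powr_mono2') (auto intro: add_pos_nonneg)
      also have "((1 + norm z) / 3) powr (- (b * r)) = 3 powr (b * r) * (1 + norm z) powr (- (b * r))"
        by (simp add: powr_divide powr_minus field_simps)
      finally show "norm (norm (h z) powr r) \<le>
          norm (C powr r * (3 powr (b * r) * (1 + norm z) powr (- (b * r))))"
        by (simp add: mult_left_mono)
    qed
  qed
  then show ?thesis using m by (simp add: Lp_space_def)
qed

text \<open>The expression \<open>N * k j s + 2 * s * k' j s\<close> is the divergence of the
  truncated field. It vanishes for the exact power, so only the outer cutoff contributes; that
  contribution keeps the size of the power itself and escapes to infinity with \<open>j\<close>.
  Only s >= 1 matters, as |z + e| > 1 in the half-space.\<close>

lemma power_cutoff_exists:
  fixes N :: real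
  assumes N: "N > 0"
  shows "\<exists>k k' C. (\<forall>j::nat. smooth_real (k j) \<and> continuous_on UNIV (k' j) \<and>
      (\<forall>s. (k j has_real_derivative k' j s) (at s)) \<and>
      (\<forall>s \<ge> 2 * real (Suc j). k j s = 0 \<and> k' j s = 0) \<and>
      (\<forall>s \<ge> 1. 0 \<le> k j s \<and> k j s \<le> s powr (- N / 2) \<and>
        \<bar>N * k j s + 2 * s * k' j s\<bar> \<le> C * s powr (- N / 2))) \<and>
    C \<ge> 0 \<and> (\<forall>s \<ge> 1. (\<lambda>j. k j s) \<longlonglongrightarrow> s powr (- N / 2) \<and> (\<lambda>j. N * k j s + 2 * s * k' j s) \<longlonglongrightarrow> 0)"
proof -
  obtain st st' where st: "smooth_real st" "smooth_real st'"
      "\<And>x. (st has_real_derivative st' x) (at x)"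
      "\<And>x. x \<le> 0 \<Longrightarrow> st x = 0" "\<And>x. 1 \<le> x \<Longrightarrow> st x = 1" "\<And>x. 0 \<le> st' x"
      "\<And>x. x \<le> 0 \<or> 1 \<le> x \<Longrightarrow> st' x = 0"
    using smooth_step_exists by metis
  have st_mono: "st x \<le> st y" if "x \<le> y" for x y
    using DERIV_nonneg_imp_nondecreasing[OF that] st(3,6) by blast
  have st01: "0 \<le> st x" "st x \<le> 1" for x
    using st_mono[of "min x 0" x] st_mono[of x "max x 1"] st(4)[of "min x 0"] st(5)[of "max x 1"]
    by auto
  obtain B where B: "\<And>x. \<bar>st' x\<bar> \<le> B" "B \<ge> 0"
    by (rule compact_support_bounded[of st' "{0..1}"])
      (use st(2,7) in \<open>auto intro: smooth_real_continuous\<close>)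
  \<comment> \<open>The first factor is 0 up to 1/4 and 1 from 1/2 on, which removes the singularity
    of the power yet leaves it intact on a neighbourhood of s >= 1. The last factor is 1 up to j + 1
    and 0 from 2(j + 1) on.\<close>
  define k where "k j s = st (4 * s + - 1) * s powr (- N / 2) * st (- (1 / real (Suc j)) * s + 2)" for j :: nat and s
  have k_smooth: "smooth_real (k j)" for j
    unfolding k_def
    by (intro smooth_real_mult smooth_real_cutoff_powr[where d = "1/4"] smooth_real_affine st(1))
      (auto intro: st(4))
  then have "\<exists>k'. smooth_real k' \<and> (\<forall>s. (k j has_real_derivative k' s) (at s))" for j
    using smooth_real_derivE by metis
  then obtain k' where k': "\<And>j. smooth_real (k' j)" "\<And>j s. (k j has_real_derivative k' j s) (at s)"
    by metis
  have k_eq: "k j s = s powr (- N / 2) * st (2 - s / real (Suc j))" if "s \<ge> 1/2" for j s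
    using that st(5) by (simp add: k_def)
  have k'_eq: "k' j s = - N / 2 * s powr (- N / 2 - 1) * st (2 - s / real (Suc j)) -
      s powr (- N / 2) * st' (2 - s / real (Suc j)) / real (Suc j)" if s: "s \<ge> 1" for j s
  proof -
    have "((\<lambda>s. st (2 - s / real (Suc j))) has_real_derivative
        st' (2 - s / real (Suc j)) * (- (1 / real (Suc j)))) (at s)"
      by (rule DERIV_chain2[OF st(3)]) (auto intro!: derivative_eq_intros)
    moreover have "((\<lambda>s. s powr (- N / 2)) has_real_derivative (- N / 2) * s powr (- N / 2 - 1)) (at s)"
      using s by (auto intro!: derivative_eq_intros)
    ultimately have "((\<lambda>s. s powr (- N / 2) * st (2 - s / real (Suc j))) has_real_derivative
        (- N / 2) * s powr (- N / 2 - 1) * st (2 - s / real (Suc j)) +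
        st' (2 - s / real (Suc j)) * (- (1 / real (Suc j))) * s powr (- N / 2)) (at s)"
      by (rule DERIV_mult[rotated])
    then have "(k j has_real_derivative
        (- N / 2) * s powr (- N / 2 - 1) * st (2 - s / real (Suc j)) +
        st' (2 - s / real (Suc j)) * (- (1 / real (Suc j))) * s powr (- N / 2)) (at s)"
      by (rule has_field_derivative_transform_within_open[of _ _ _ "{1/2<..}"])
        (use s k_eq in auto)
    from DERIV_unique[OF k'(2) this] show ?thesis
      by (simp add: mult.commute)
  qed
  \<comment> \<open>Differentiating the power gives exactly \<open>- N * k j s\<close>, which
    cancels; the derivative of the outer cutoff is all that remains.\<close>
  have div_eq: "N * k j s + 2 * s * k' j s =
      - 2 * (s / real (Suc j)) * s powr (- N / 2) * st' (2 - s / real (Suc j))" if s: "s \<ge> 1" for j s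
  proof -
    have "s * s powr (- N / 2 - 1) = s powr (- N / 2)"
      using s by (simp add: powr_diff)
    then have "2 * s * k' j s = - N * (s powr (- N / 2) * st (2 - s / real (Suc j))) -
        2 * (s / real (Suc j)) * s powr (- N / 2) * st' (2 - s / real (Suc j))"
      unfolding k'_eq[OF s] by (simp add: algebra_simps)
    then show ?thesis using k_eq[of s j] s by simp
  qed
  have large: "st' (2 - s / real (Suc j)) = 0" "st (2 - s / real (Suc j)) = 0" if "s \<ge> 2 * real (Suc j)" for s j
  proof -
    have "2 - s / real (Suc j) \<le> 0" using that by (simp add: field_simps)
    then show "st' (2 - s / real (Suc j)) = 0" "st (2 - s / real (Suc j)) = 0"
      using st(4,7) by auto
  qed
  have eventually_small: "eventually (\<lambda>j. 1 \<le> 2 - s / real (Suc j)) sequentially" for s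
  proof -
    obtain j0 :: nat where "s < real j0" using reals_Archimedean2 by blast
    then show ?thesis
      by (intro eventually_sequentiallyI[of j0]) (auto simp: field_simps)
  qed
  show ?thesis
  proof (rule exI[of _ k], rule exI[of _ k'], rule exI[of _ "4 * B"], intro conjI allI impI)
    fix j s
    show "smooth_real (k j)" "(k j has_real_derivative k' j s) (at s)"
      by (rule k_smooth k')+
    show "continuous_on UNIV (k' j)" using k'(1) by (rule smooth_real_continuous)
    show "0 \<le> 4 * B" using B by simp
    show "k j s = 0" "k' j s = 0" if "2 * real (Suc j) \<le> s"
      using large[OF that] k_eq[of s j] k'_eq[of s j] that by auto
    assume s: "1 \<le> s"
    show "0 \<le> k j s" "k j s \<le> s powr (- N / 2)"
      using s st01 by (auto simp: k_eq intro: mult_left_le)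
    show "\<bar>N * k j s + 2 * s * k' j s\<bar> \<le> 4 * B * s powr (- N / 2)"
    proof (cases "s \<ge> 2 * real (Suc j)")
      case True
      then show ?thesis using div_eq[OF s] large B by simp
    next
      case False
      \<comment> \<open>In the transition region s/(j+1) is at most 2; with the prefactor 2 and the
        bound \<open>B\<close> for \<open>st'\<close> this yields the constant \<open>4 * B\<close>,
        uniformly in \<open>j\<close>.\<close>
      then have "s / real (Suc j) \<le> 2" by (simp add: field_simps)
      then have "2 * (s / real (Suc j)) * s powr (- N / 2) * \<bar>st' (2 - s / real (Suc j))\<bar> \<le>
          2 * 2 * s powr (- N / 2) * B"
        using s B by (intro mult_mono) auto
      then show ?thesis unfolding div_eq[OF s] using s by (simp add: abs_mult mult_ac)
    qed
    have "eventually (\<lambda>j. k j s = s powr (- N / 2)) sequentially"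
      using eventually_small[of s] by eventually_elim (use s st(5) in \<open>simp add: k_eq\<close>)
    then show "(\<lambda>j. k j s) \<longlonglongrightarrow> s powr (- N / 2)" by (rule tendsto_eventually)
    have "eventually (\<lambda>j. N * k j s + 2 * s * k' j s = 0) sequentially"
      using eventually_small[of s] by eventually_elim (use st(7) in \<open>simp add: div_eq[OF s]\<close>)
    then show "(\<lambda>j. N * k j s + 2 * s * k' j s) \<longlonglongrightarrow> 0" by (rule tendsto_eventually)
  qed
qed

section \<open>Flux and trace\<close>

text \<open>Every approximant in \<open>has_trace\<close> is continuous up to the boundary and so
  satisfies the integration by parts. The factors \<open>Q\<close>, \<open>X\<close>,
  \<open>\<kappa>\<close> are continuous with compact support, hence lie in all dual spaces, and the
  three convergences of \<open>has_trace\<close> match the three integrals.\<close>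

lemma trace_identity:
  fixes u :: "(real^'n) \<times> real \<Rightarrow> real" and t :: "real^'n \<Rightarrow> real"
  defines "e \<equiv> (0, 1) :: (real^'n) \<times> real"
  assumes p: "1 < p" "p < real CARD('n) + 1"
    and u: "u \<in> hom_sobolev halfspace p" and tr: "has_trace p u t" and t: "continuous_on UNIV t"
    and k: "smooth_real k" "continuous_on UNIV k'" "\<And>x. (k has_real_derivative k' x) (at x)"
      "\<And>s. s \<ge> M \<Longrightarrow> k s = 0" "\<And>s. s \<ge> M \<Longrightarrow> k' s = 0"
  shows "(LINT z|lebesgue_on halfspace. u z * (real (CARD('n) + 1) * k ((norm (z + e))\<^sup>2) +
            2 * (norm (z + e))\<^sup>2 * k' ((norm (z + e))\<^sup>2))) +
      (LINT z|lebesgue_on halfspace. weak_gradient halfspace u z \<bullet> (k ((norm (z + e))\<^sup>2) *\<^sub>R (z + e))) =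
      - (LINT x|lebesgue. t x * k (1 + (norm x)\<^sup>2))"
proof -
  let ?H = "halfspace :: ((real^'n) \<times> real) set"
  let ?s = "\<lambda>z :: (real^'n) \<times> real. (norm (z + e))\<^sup>2"
  have H: "?H \<in> sets lebesgue" by (simp add: open_halfspace)
  define N where "N = real CARD('n) + 1"
  have N: "p < N" "2 \<le> N" using p zero_less_card_finite[where 'a = 'n] by (auto simp: N_def)
  define P where "P = N * p / (N - p)"
  define q where "q = real CARD('n) * p / (N - p)"
  have P: "1 < P"
  proof -
    have "N - p < N * p" using mult_strict_left_mono[OF p(1), of N] N p(1) by linarith
    then show ?thesis using N by (simp add: P_def less_divide_eq)
  qed
  have q: "1 < q"
  proof -
    have "N < N * p" using mult_strict_left_mono[OF p(1), of N] N by simp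
    then have "N - p < real CARD('n) * p" by (simp add: N_def algebra_simps)
    then show ?thesis using N by (simp add: q_def less_divide_eq)
  qed
  have ck: "continuous_on UNIV k" using k(1) by (rule smooth_real_continuous)
  define K where "K = cball (- e) (sqrt M)"
  have K: "compact K" by (simp add: K_def)
  have outK: "?s z \<ge> M" if "z \<notin> K" for z
    using that unfolding K_def by (rule outside_cball_norm_add_square)
  have cs: "continuous_on S (\<lambda>z. k (?s z))" "continuous_on S (\<lambda>z. k' (?s z))" for S
    by (intro continuous_on_compose2[OF ck] continuous_on_compose2[OF k(2)] continuous_intros; simp)+
  define X where "X z = k (?s z) *\<^sub>R (z + e)" for z
  define Q where "Q z = real (CARD('n) + 1) * k (?s z) + 2 * ?s z * k' (?s z)" for z
  define \<kappa> where "\<kappa> x = k (1 + (norm x)\<^sup>2)" for x :: "real^'n"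
  have X: "X \<in> Lp_space ?H r" if "r > 0" for r
    unfolding X_def
    by (intro Lp_space_continuous_compact_support[OF _ K] continuous_intros cs H that)
      (use k(4) outK in auto)
  have Q: "Q \<in> Lp_space ?H r" if "r > 0" for r
    unfolding Q_def
    by (intro Lp_space_continuous_compact_support[OF _ K] continuous_intros cs H that)
      (use k(4,5) outK in auto)
  define L where "L = cball (0 :: real^'n) (sqrt M)"
  have L: "compact L" by (simp add: L_def)
  have c\<kappa>: "continuous_on UNIV \<kappa>"
    unfolding \<kappa>_def by (intro continuous_on_compose2[OF ck] continuous_intros) simp
  have \<kappa>0: "\<kappa> x = 0" if "x \<notin> L" for x
    using outside_cball_norm_add_square[of x 0 M] that k(4) by (simp add: L_def \<kappa>_def)
  have \<kappa>: "\<kappa> \<in> Lp_space UNIV r" if "r > 0" for r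
    by (intro Lp_space_continuous_compact_support[OF c\<kappa> L \<kappa>0] that) simp_all
  have N_eq: "real (CARD('n) + 1) = N" by (simp add: N_def)
  obtain U where U_all: "\<forall>i. U i \<in> hom_sobolev ?H p \<and> continuous_on (closure ?H) (U i)"
    and U_lim: "Lp_tendsto ?H P U u"
    "Lp_tendsto ?H p (\<lambda>i. weak_gradient ?H (U i)) (weak_gradient ?H u)"
    "Lp_tendsto UNIV q (\<lambda>i x. U i (x, 0)) t"
    using tr unfolding has_trace_def N_eq P_def[symmetric] q_def[symmetric]
    by (elim exE conjE)
  then have U: "U i \<in> hom_sobolev ?H p" "continuous_on (closure ?H) (U i)" for i
    by auto
  have inLP: "v \<in> Lp_space ?H P" if "v \<in> hom_sobolev ?H p" for v
    using that by (simp add: hom_sobolev_def P_def N_def add.commute)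
  have pos: "0 < P / (P - 1)" "0 < q / (q - 1)" "0 < p / (p - 1)"
    using P q p by auto
  have iQ: "integrable (lebesgue_on ?H) (\<lambda>z. v z * Q z)" if "v \<in> hom_sobolev ?H p" for v
    using Hoelder_inner(1)[OF P conjugate_exponent[OF P] inLP[OF that] Q[OF pos(1)]] by simp
  have iX: "integrable (lebesgue_on ?H) (\<lambda>z. weak_gradient ?H v z \<bullet> X z)" if "v \<in> hom_sobolev ?H p" for v
    by (rule Hoelder_inner(1)[OF p(1) conjugate_exponent[OF p(1)]
          hom_sobolev_weak_gradient(2)[OF open_halfspace that] X[OF pos(3)]])
  \<comment> \<open>The integral of a difference splits only when both parts are integrable. On the
    boundary this follows from continuity of \<open>U i\<close> and \<open>t\<close> and the compact
    support of \<open>\<kappa>\<close>.\<close>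
  have i\<kappa>: "integrable lebesgue (\<lambda>x. h x * \<kappa> x)" if "continuous_on UNIV h" for h
  proof -
    have "integrable (lebesgue_on UNIV) (\<lambda>x. h x * \<kappa> x)"
      using locally_integrable_continuous[OF that] L \<kappa>0
      by (intro integrable_mult_compact_support[OF _ c\<kappa> L]) (auto simp: locally_integrable_def)
    then show ?thesis by (simp add: lebesgue_on_UNIV_eq)
  qed
  have cU: "continuous_on UNIV (\<lambda>x. U i (x, 0))" for i
    by (rule continuous_on_compose2[OF U(2)[of i]]) (auto simp: closure_halfspace intro!: continuous_intros)
  have ident: "(LINT z|lebesgue_on ?H. U i z * Q z) +
      (LINT z|lebesgue_on ?H. weak_gradient ?H (U i) z \<bullet> X z) = - (LINT x|lebesgue. U i (x, 0) * \<kappa> x)" for i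
    using radial_field_integration_by_parts[OF k U(2)[of i]
        hom_sobolev_weak_gradient(1)[OF open_halfspace U(1)[of i]] p(1)
        hom_sobolev_weak_gradient(2)[OF open_halfspace U(1)[of i]]]
    unfolding Q_def X_def \<kappa>_def e_def .
  have limQ: "(\<lambda>i. LINT z|lebesgue_on ?H. U i z * Q z) \<longlonglongrightarrow> (LINT z|lebesgue_on ?H. u z * Q z)"
  proof -
    have "(\<lambda>i. LINT z|lebesgue_on ?H. (U i z - u z) \<bullet> Q z) \<longlonglongrightarrow> 0"
      by (rule Lp_tendsto_inner[OF P conjugate_exponent[OF P] U_lim(1) Q[OF pos(1)]])
    then have "(\<lambda>i. (LINT z|lebesgue_on ?H. U i z * Q z) - (LINT z|lebesgue_on ?H. u z * Q z)) \<longlonglongrightarrow> 0"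
      using iQ[OF U(1)] iQ[OF u] by (simp add: left_diff_distrib)
    then show ?thesis by (simp add: LIM_zero_iff)
  qed
  have limX: "(\<lambda>i. LINT z|lebesgue_on ?H. weak_gradient ?H (U i) z \<bullet> X z) \<longlonglongrightarrow>
      (LINT z|lebesgue_on ?H. weak_gradient ?H u z \<bullet> X z)"
  proof -
    have "(\<lambda>i. LINT z|lebesgue_on ?H. (weak_gradient ?H (U i) z - weak_gradient ?H u z) \<bullet> X z) \<longlonglongrightarrow> 0"
      by (rule Lp_tendsto_inner[OF p(1) conjugate_exponent[OF p(1)] U_lim(2) X[OF pos(3)]])
    then have "(\<lambda>i. (LINT z|lebesgue_on ?H. weak_gradient ?H (U i) z \<bullet> X z) -
        (LINT z|lebesgue_on ?H. weak_gradient ?H u z \<bullet> X z)) \<longlonglongrightarrow> 0"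
      using iX[OF U(1)] iX[OF u] by (simp add: inner_diff_left)
    then show ?thesis by (simp add: LIM_zero_iff)
  qed
  have lim\<kappa>: "(\<lambda>i. LINT x|lebesgue. U i (x, 0) * \<kappa> x) \<longlonglongrightarrow> (LINT x|lebesgue. t x * \<kappa> x)"
  proof -
    have "(\<lambda>i. LINT x|lebesgue_on UNIV. (U i (x, 0) - t x) \<bullet> \<kappa> x) \<longlonglongrightarrow> 0"
      by (rule Lp_tendsto_inner[OF q conjugate_exponent[OF q] U_lim(3) \<kappa>[OF pos(2)]])
    then have "(\<lambda>i. (LINT x|lebesgue. U i (x, 0) * \<kappa> x) - (LINT x|lebesgue. t x * \<kappa> x)) \<longlonglongrightarrow> 0"
      using i\<kappa>[OF cU] i\<kappa>[OF t] by (simp add: left_diff_distrib lebesgue_on_UNIV_eq)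
    then show ?thesis by (simp add: LIM_zero_iff)
  qed
  have "(LINT z|lebesgue_on ?H. u z * Q z) +
      (LINT z|lebesgue_on ?H. weak_gradient ?H u z \<bullet> X z) = - (LINT x|lebesgue. t x * \<kappa> x)"
    using LIMSEQ_unique[OF tendsto_add[OF limQ limX, unfolded ident] tendsto_minus[OF lim\<kappa>]] .
  then show ?thesis by (simp add: Q_def X_def \<kappa>_def)
qed

lemma square_powr: "0 < r \<Longrightarrow> (r\<^sup>2) powr a = r powr (2 * a)" for r :: real
  by (simp add: powr_powr flip: powr_numeral)

text \<open>At a fixed truncation both functions have the same boundary integral, so the two
  interior sums agree before any limit is taken. As \<open>j\<close> grows, \<open>X j\<close> tends
  to \<open>G\<close> with norm at most that of \<open>G\<close>, and the divergence
  \<open>Q j\<close> tends to 0 under an admissible bound; what is left are the two fluxes.\<close>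

lemma flux_determined_by_trace:
  fixes u w :: "(real^'n) \<times> real \<Rightarrow> real" and t :: "real^'n \<Rightarrow> real"
  defines "e \<equiv> (0, 1) :: (real^'n) \<times> real"
  defines "G \<equiv> \<lambda>z. ((norm (z + e))\<^sup>2) powr (- (real CARD('n) + 1) / 2) *\<^sub>R (z + e)"
  assumes p: "1 < p" "p < real CARD('n) + 1"
    and u: "u \<in> hom_sobolev halfspace p" "has_trace p u t"
    and w: "w \<in> hom_sobolev halfspace p" "has_trace p w t" and t: "continuous_on UNIV t"
  shows "G \<in> Lp_space halfspace (p / (p - 1))"
    and "(LINT z|lebesgue_on halfspace. weak_gradient halfspace u z \<bullet> G z) =
      (LINT z|lebesgue_on halfspace. weak_gradient halfspace w z \<bullet> G z)"
proof -
  let ?H = "halfspace :: ((real^'n) \<times> real) set"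
  let ?s = "\<lambda>z :: (real^'n) \<times> real. (norm (z + e))\<^sup>2"
  have H: "?H \<in> sets lebesgue" by (simp add: open_halfspace)
  define N where "N = real CARD('n) + 1"
  have N: "p < N" "2 \<le> N" using p zero_less_card_finite[where 'a = 'n] by (auto simp: N_def)
  define P where "P = N * p / (N - p)"
  have P: "1 < P"
  proof -
    have "N - p < N * p" using mult_strict_left_mono[OF p(1), of N] N p(1) by linarith
    then show ?thesis using N by (simp add: P_def less_divide_eq)
  qed
  have Hn: "norm (z + e) > 1" if "z \<in> ?H" for z
    using halfspace_norm_add(1)[OF that] by (simp add: e_def)
  have s_powr: "?s z powr (- N / 2) = norm (z + e) powr (- N)" if "z \<in> ?H" for z
  proof -
    have "norm (z + e) > 0" using Hn[OF that] by linarith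
    from square_powr[OF this, of "- N / 2"] show ?thesis by simp
  qed
  have normG: "norm (G z) = norm (z + e) powr (- (N - 1))" if "z \<in> ?H" for z
  proof -
    have r: "norm (z + e) > 0" using Hn[OF that] by linarith
    have "norm (G z) = norm (z + e) powr (- N) * norm (z + e) powr 1"
      using s_powr[OF that] r by (simp add: G_def N_def)
    also have "\<dots> = norm (z + e) powr (- (N - 1))"
      unfolding powr_add[symmetric] by simp
    finally show ?thesis .
  qed
  show G: "G \<in> Lp_space ?H (p / (p - 1))"
  proof (rule Lp_space_halfspace_decay)
    show "G \<in> borel_measurable borel" unfolding G_def by measurable
    show "0 < p / (p - 1)" using p by simp
    \<comment> \<open>This is \<open>p < N\<close> rearranged: exactly the condition under which
      decay of order N - 1 is integrable to the dual power p / (p - 1).\<close>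
    have "N * (p - 1) < (N - 1) * p" using N by (simp add: algebra_simps)
    then show "real CARD('n) + 1 < (N - 1) * (p / (p - 1))"
      using p by (simp add: N_def less_divide_eq)
    show "norm (G z) \<le> 1 * norm (z + (0, 1)) powr (- (N - 1))" if "z \<in> ?H" for z
      using normG[OF that] by (simp add: e_def)
  qed simp
  have "N > 0" using N by simp
  obtain k k' C where k_all: "\<forall>j::nat. smooth_real (k j) \<and> continuous_on UNIV (k' j) \<and>
      (\<forall>s. (k j has_real_derivative k' j s) (at s)) \<and>
      (\<forall>s \<ge> 2 * real (Suc j). k j s = 0 \<and> k' j s = 0) \<and>
      (\<forall>s \<ge> 1. 0 \<le> k j s \<and> k j s \<le> s powr (- N / 2) \<and>
        \<bar>N * k j s + 2 * s * k' j s\<bar> \<le> C * s powr (- N / 2))"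
    and C: "C \<ge> 0" and k_lim: "\<forall>s \<ge> 1. (\<lambda>j. k j s) \<longlonglongrightarrow> s powr (- N / 2) \<and>
      (\<lambda>j. N * k j s + 2 * s * k' j s) \<longlonglongrightarrow> 0"
    using power_cutoff_exists[OF \<open>N > 0\<close>] by (elim exE conjE)
  have k: "smooth_real (k j)" "continuous_on UNIV (k' j)" "(k j has_real_derivative k' j s) (at s)"
      "s \<ge> 2 * real (Suc j) \<Longrightarrow> k j s = 0" "s \<ge> 2 * real (Suc j) \<Longrightarrow> k' j s = 0" for j s
    using k_all by simp_all
  have kb: "0 \<le> k j s \<and> k j s \<le> s powr (- N / 2)"
      "\<bar>N * k j s + 2 * s * k' j s\<bar> \<le> C * s powr (- N / 2)" if "s \<ge> 1" for j s
    using k_all that by simp_all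
  have kl: "(\<lambda>j. k j s) \<longlonglongrightarrow> s powr (- N / 2)"
      "(\<lambda>j. N * k j s + 2 * s * k' j s) \<longlonglongrightarrow> 0" if "s \<ge> 1" for s
    using k_lim that by simp_all
  have s1: "?s z \<ge> 1" if "z \<in> ?H" for z
    using Hn[OF that] one_le_power[of "norm (z + e)" 2] by simp
  define Q where "Q j z = N * k j (?s z) + 2 * ?s z * k' j (?s z)" for j z
  define X where "X j z = k j (?s z) *\<^sub>R (z + e)" for j z
  have mQX: "Q j \<in> borel_measurable (lebesgue_on ?H)" "X j \<in> borel_measurable (lebesgue_on ?H)" for j
  proof -
    have c: "continuous_on UNIV (\<lambda>z. k j (?s z))" "continuous_on UNIV (\<lambda>z. k' j (?s z))"
      by (intro continuous_on_compose2[OF smooth_real_continuous[OF k(1), of UNIV]]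
          continuous_on_compose2[OF k(2)] continuous_intros; simp)+
    have "continuous_on UNIV (Q j)" "continuous_on UNIV (X j)"
      unfolding Q_def X_def by (intro continuous_intros c)+
    then show "Q j \<in> borel_measurable (lebesgue_on ?H)" "X j \<in> borel_measurable (lebesgue_on ?H)"
      by (auto intro!: measurable_restrict_space1 measurable_completion borel_measurable_continuous_onI)
  qed
  have lim: "(\<lambda>j. (LINT z|lebesgue_on ?H. v z * Q j z) +
        (LINT z|lebesgue_on ?H. weak_gradient ?H v z \<bullet> X j z)) \<longlonglongrightarrow>
      (LINT z|lebesgue_on ?H. weak_gradient ?H v z \<bullet> G z)"
    if v: "v \<in> hom_sobolev ?H p" for v
  proof -
    have vP: "v \<in> Lp_space ?H P"
      using v by (simp add: hom_sobolev_def P_def N_def add.commute)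
    have vm: "v \<in> borel_measurable (lebesgue_on ?H)" using vP by (simp add: Lp_space_def)
    have gv: "weak_gradient ?H v \<in> Lp_space ?H p"
      by (rule hom_sobolev_weak_gradient(2)[OF open_halfspace v])
    have gm: "weak_gradient ?H v \<in> borel_measurable (lebesgue_on ?H)" using gv by (simp add: Lp_space_def)
    have Gm: "G \<in> borel_measurable (lebesgue_on ?H)" using G by (simp add: Lp_space_def)
    \<comment> \<open>Decay of order N is just short of integrability, but the exponent P / (P - 1)
      exceeds 1. This is why membership of \<open>v\<close> in the critical space L^P suffices to
      discard the divergence term.\<close>
    have D: "(\<lambda>z. C * ?s z powr (- N / 2)) \<in> Lp_space ?H (P / (P - 1))"
    proof (rule Lp_space_halfspace_decay)
      show "0 < P / (P - 1)" using P by simp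
      show "real CARD('n) + 1 < N * (P / (P - 1))"
        using mult_strict_left_mono[OF conjugate_exponent(1)[OF P], of N] N by (simp add: N_def)
      show "norm (C * ?s z powr (- N / 2)) \<le> C * norm (z + (0, 1)) powr (- N)" if "z \<in> ?H" for z
        using s_powr[OF that] C by (simp add: e_def)
    qed (use C in \<open>simp_all add: measurable\<close>)
    have "(\<lambda>j. LINT z|lebesgue_on ?H. v z * Q j z) \<longlonglongrightarrow> (LINT z|lebesgue_on ?H. 0)"
    proof (rule integral_dominated_convergence[where w = "\<lambda>z. \<bar>v z\<bar> * (C * ?s z powr (- N / 2))"])
      show "integrable (lebesgue_on ?H) (\<lambda>z. \<bar>v z\<bar> * (C * ?s z powr (- N / 2)))"
        using integrable_abs[OF Hoelder_inner(1)[OF P conjugate_exponent[OF P] vP D]] C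
        by (simp add: abs_mult)
      show "AE z in lebesgue_on ?H. (\<lambda>j. v z * Q j z) \<longlonglongrightarrow> 0"
        using kl(2)[OF s1] by (intro AE_I2 tendsto_mult_right_zero) (simp add: Q_def space_restrict_space)
      show "AE z in lebesgue_on ?H. norm (v z * Q j z) \<le> \<bar>v z\<bar> * (C * ?s z powr (- N / 2))" for j
        using kb(2)[OF s1] by (intro AE_I2) (simp add: Q_def abs_mult mult_left_mono space_restrict_space)
    qed (use vm mQX in auto)
    moreover have "(\<lambda>j. LINT z|lebesgue_on ?H. weak_gradient ?H v z \<bullet> X j z) \<longlonglongrightarrow>
        (LINT z|lebesgue_on ?H. weak_gradient ?H v z \<bullet> G z)"
    proof (rule integral_dominated_convergence[where w = "\<lambda>z. norm (weak_gradient ?H v z) * norm (G z)"])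
      have "(\<lambda>z. norm (weak_gradient ?H v z)) \<in> Lp_space ?H p" "(\<lambda>z. norm (G z)) \<in> Lp_space ?H (p / (p - 1))"
        using gv G by (auto simp: Lp_space_def)
      from Hoelder_inner(1)[OF p(1) conjugate_exponent[OF p(1)] this]
      show "integrable (lebesgue_on ?H) (\<lambda>z. norm (weak_gradient ?H v z) * norm (G z))" by simp
      show "AE z in lebesgue_on ?H. (\<lambda>j. weak_gradient ?H v z \<bullet> X j z) \<longlonglongrightarrow> weak_gradient ?H v z \<bullet> G z"
        unfolding X_def G_def using kl(1)[OF s1] by (intro AE_I2 tendsto_intros) (simp add: N_def space_restrict_space)
      show "AE z in lebesgue_on ?H. norm (weak_gradient ?H v z \<bullet> X j z) \<le>
          norm (weak_gradient ?H v z) * norm (G z)" for j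
      proof (rule AE_I2)
        fix z assume "z \<in> space (lebesgue_on ?H)"
        then have z: "z \<in> ?H" by (simp add: space_restrict_space)
        have "norm (X j z) \<le> norm (G z)"
          using kb(1)[OF s1[OF z], of j] by (auto simp: X_def G_def N_def intro!: mult_right_mono)
        then show "norm (weak_gradient ?H v z \<bullet> X j z) \<le> norm (weak_gradient ?H v z) * norm (G z)"
          using Cauchy_Schwarz_ineq2[of "weak_gradient ?H v z" "X j z"]
          by (simp add: order_trans[OF _ mult_left_mono])
      qed
    qed (use gm mQX Gm in auto)
    ultimately show ?thesis using tendsto_add by fastforce
  qed
  have N_eq: "real (CARD('n) + 1) = N" by (simp add: N_def)
  have id: "(LINT z|lebesgue_on ?H. v z * Q j z) + (LINT z|lebesgue_on ?H. weak_gradient ?H v z \<bullet> X j z) =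
      - (LINT x|lebesgue. t x * k j (1 + (norm x)\<^sup>2))"
    if "v \<in> hom_sobolev ?H p" "has_trace p v t" for v j
    using trace_identity[OF p that t k(1-3)[of j] k(4,5)[where j = j]]
    unfolding Q_def X_def e_def N_eq .
  show "(LINT z|lebesgue_on ?H. weak_gradient ?H u z \<bullet> G z) = (LINT z|lebesgue_on ?H. weak_gradient ?H w z \<bullet> G z)"
    using LIMSEQ_unique[OF lim[OF u(1)]] lim[OF w(1)] unfolding id[OF u] id[OF w] by blast
qed

section \<open>Minimality\<close>

theorem proposition9:
  fixes p q c0 :: real and f :: "(real^'n) \<times> real \<Rightarrow> real"
  assumes p: "1 < p" "p < real CARD('n) + 1"
    and q: "1 / q = (real CARD('n) + 1) / (real CARD('n) * p) - 1 / real CARD('n)"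
    and f: "f = (\<lambda>(x, y). c0 * ((1 + y)\<^sup>2 + (norm x)\<^sup>2)
              powr (- ((real CARD('n) + 1 - p) / (2 * (p - 1)))))"
    and c0: "c0 > 0" "(LINT x|lebesgue. \<bar>f (x, 0)\<bar> powr q) = 1"
  shows "f \<in> admissible p c0 \<and> (\<forall>\<omega> \<in> (admissible p c0 :: ((real^'n) \<times> real \<Rightarrow> real) set).
    energy p f \<le> energy p \<omega>)"
proof -
  let ?H = "halfspace :: ((real^'n) \<times> real) set"
  define e where "e = ((0, 1) :: (real^'n) \<times> real)"
  let ?s = "\<lambda>z :: (real^'n) \<times> real. (norm (z + e))\<^sup>2"
  define N where "N = real CARD('n) + 1"
  have N: "p < N" "2 \<le> N" using p zero_less_card_finite[where 'a = 'n] by (auto simp: N_def)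
  have N_eq: "real (CARD('n) + 1) = N" by (simp add: N_def)
  define \<beta> where "\<beta> = (N - p) / (2 * (p - 1))"
  \<comment> \<open>The factor in the gradient: differentiating c0 s^(- \<beta>) at s = |z + e|^2
    brings down \<open>- \<beta>\<close>, and s contributes 2 (z + e).\<close>
  define a where "a = 2 * c0 * \<beta>"
  have \<beta>: "\<beta> > 0" using p N by (simp add: \<beta>_def)
  have a: "a > 0" using c0 \<beta> by (simp add: a_def)
  have s_Pair: "?s (x, y) = (1 + y)\<^sup>2 + (norm x)\<^sup>2" for x y
    by (simp add: e_def norm_Pair add.commute)
  have f_eq: "f z = c0 * ?s z powr (- \<beta>)" for z
    by (cases z) (simp add: f s_Pair \<beta>_def N_def)
  define t where "t x = c0 * (1 + (norm x)\<^sup>2) powr (- \<beta>)" for x :: "real^'n"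
  define F where "F z = (- (a * ?s z powr (- \<beta> - 1))) *\<^sub>R (z + e)" for z
  define G where "G z = ?s z powr (- N / 2) *\<^sub>R (z + e)" for z
  have Hn: "norm (z + e) > 0" if "z \<in> ?H" for z
    using halfspace_norm_add(1)[OF that] unfolding e_def by linarith
  have closure_ne: "z + e \<noteq> 0" if "z \<in> closure ?H" for z
    using that by (auto simp: closure_halfspace e_def prod_eq_iff)
  have f_deriv: "(f has_derivative (\<lambda>v. F z \<bullet> v)) (at z)" if "z \<in> ?H" for z
  proof -
    have "((\<lambda>z. (z + e) \<bullet> (z + e)) has_derivative (\<lambda>v. 2 * ((z + e) \<bullet> v))) (at z)"
      by (auto intro!: derivative_eq_intros simp: inner_commute)
    then have 1: "(?s has_derivative (\<lambda>v. 2 * ((z + e) \<bullet> v))) (at z)"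
      by (simp add: power2_norm_eq_inner)
    have "((\<lambda>s. c0 * s powr (- \<beta>)) has_real_derivative c0 * (- \<beta> * ?s z powr (- \<beta> - 1))) (at (?s z))"
      using Hn[OF that] by (auto intro!: derivative_eq_intros)
    from has_derivative_compose[OF 1 this[unfolded has_field_derivative_def]]
    show ?thesis
      unfolding f_eq[abs_def] by (simp add: F_def a_def mult_ac)
  qed
  have cF: "continuous_on ?H F"
    unfolding F_def using Hn
    by (intro continuous_intros) (auto simp: less_imp_neq[symmetric])
  have cf: "continuous_on (closure ?H) f"
    unfolding f_eq[abs_def] using closure_ne by (intro continuous_intros) auto
  have ct: "continuous_on UNIV t"
    unfolding t_def by (intro continuous_intros) (auto simp: add_nonneg_eq_0_iff)
  have wF: "is_weak_gradient ?H f F"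
    by (rule is_weak_gradient_classical[OF open_halfspace f_deriv cF])
  have normF: "norm (F z) = a * norm (z + e) powr (- (2 * \<beta> + 1))" if "z \<in> ?H" for z
  proof -
    have "norm (F z) = a * (norm (z + e) powr (2 * (- \<beta> - 1)) * norm (z + e) powr 1)"
      using a Hn[OF that] by (simp add: F_def abs_mult square_powr)
    also have "\<dots> = a * norm (z + e) powr (- (2 * \<beta> + 1))"
      unfolding powr_add[symmetric] by (simp add: algebra_simps)
    finally show ?thesis .
  qed
  have normG: "norm (G z) = norm (z + e) powr (- (N - 1))" if "z \<in> ?H" for z
  proof -
    have "norm (G z) = norm (z + e) powr (2 * (- N / 2)) * norm (z + e) powr 1"
      using Hn[OF that] by (simp add: G_def square_powr)
    also have "\<dots> = norm (z + e) powr (- (N - 1))"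
      unfolding powr_add[symmetric] by simp
    finally show ?thesis .
  qed
  \<comment> \<open>The exponent form of p-harmonicity: |F|^(p-1) decays with the same power of |z +
    e| as |G|.\<close>
  have \<beta>1: "(2 * \<beta> + 1) * (p - 1) = N - 1" using p by (simp add: \<beta>_def field_simps)
  have F_Lp: "F \<in> Lp_space ?H p"
  proof (rule Lp_space_halfspace_decay)
    show "F \<in> borel_measurable borel" unfolding F_def by measurable
    \<comment> \<open>By \<open>\<beta>1\<close> this product equals N + 2 \<beta>, so the gradient
      decays fast enough for L^p.\<close>
    have "(2 * \<beta> + 1) * p = (2 * \<beta> + 1) * (p - 1) + (2 * \<beta> + 1)" by (simp add: algebra_simps)
    also have "\<dots> > N" using \<beta>1 \<beta> by simp
    finally show "real CARD('n) + 1 < (2 * \<beta> + 1) * p" by (simp add: N_def)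
    show "norm (F z) \<le> a * norm (z + (0, 1)) powr (- (2 * \<beta> + 1))" if "z \<in> ?H" for z
      using normF[OF that] by (simp add: e_def)
  qed (use p a in auto)
  have f_Lp: "f \<in> Lp_space ?H (N * p / (N - p))"
  proof (rule Lp_space_halfspace_decay)
    show "f \<in> borel_measurable borel" unfolding f_eq[abs_def] by measurable
    show "0 < N * p / (N - p)" using N p by simp
    \<comment> \<open>The factor N - p cancels against the critical exponent, leaving N p / (p - 1),
      which exceeds N.\<close>
    have "2 * \<beta> * (p - 1) = N - p" using p by (simp add: \<beta>_def field_simps)
    from this[symmetric] have "2 * \<beta> * (N * p / (N - p)) = N * (p / (p - 1))"
      using \<beta> p by simp
    also have "\<dots> > N * 1" using N conjugate_exponent(1)[OF p(1)] by (intro mult_strict_left_mono) auto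
    finally show "real CARD('n) + 1 < 2 * \<beta> * (N * p / (N - p))" by (simp add: N_def)
    show "norm (f z) \<le> c0 * norm (z + (0, 1)) powr (- (2 * \<beta>))" if "z \<in> ?H" for z
      using square_powr[OF Hn[OF that], of "- \<beta>"] c0 by (simp add: f_eq abs_mult e_def)
  qed (use c0 in auto)
  have f_hom: "f \<in> hom_sobolev ?H p"
    using f_Lp F_Lp wF unfolding hom_sobolev_def by (auto simp: N_def add.commute)
  have f_trace: "has_trace p f t"
    unfolding has_trace_def
  \<comment> \<open>As \<open>f\<close> is continuous up to the boundary and equals \<open>t\<close>
    there, the constant sequence realises the trace.\<close>
  proof (intro exI[of _ "\<lambda>k. f"] conjI allI)
    have "f (x, 0) = t x" for x
      unfolding f_eq s_Pair t_def by simp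
    then show "Lp_tendsto UNIV (real CARD('n) * p / (real (CARD('n) + 1) - p)) (\<lambda>k x. f (x, 0)) t"
      by (simp add: Lp_tendsto_def Lp_space_def Lp_norm_def)
  qed (use f_hom cf in \<open>auto simp: Lp_tendsto_def Lp_space_def Lp_norm_def\<close>)
  have t_eq: "(\<lambda>x. c0 * (1 + (norm x)\<^sup>2) powr (- ((real CARD('n) + 1 - p) / (2 * (p - 1))))) = t"
    by (simp add: t_def[abs_def] \<beta>_def N_def)
  have f_adm: "f \<in> admissible p c0"
    unfolding admissible_def t_eq using f_hom f_trace
    by (auto simp: f intro!: exI[of _ "\<lambda>s. c0 * s powr (- ((real CARD('n) + 1 - p) / (2 * (p - 1))))"])
  have wgf: "AE z in lebesgue_on ?H. weak_gradient ?H f z = F z"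
    by (rule weak_gradient_AE_eq[OF open_halfspace wF])
  have Fm: "F \<in> borel_measurable (lebesgue_on ?H)" and iF: "integrable (lebesgue_on ?H) (\<lambda>z. norm (F z) powr p)"
    using F_Lp by (auto simp: Lp_space_def)
  have gfm: "weak_gradient ?H f \<in> borel_measurable (lebesgue_on ?H)"
    using hom_sobolev_weak_gradient(2)[OF open_halfspace f_hom] by (simp add: Lp_space_def)
  have Gm: "G \<in> borel_measurable (lebesgue_on ?H)"
    unfolding G_def by (intro measurable_restrict_space1 measurable_completion) measurable
  have energy_f: "energy p f = (LINT z|lebesgue_on ?H. norm (F z) powr p)"
    unfolding energy_def using wgf Fm gfm by (intro integral_cong_AE) (auto elim!: AE_mp)
  have "energy p f \<le> energy p \<omega>" if \<omega>: "\<omega> \<in> admissible p c0" for \<omega> :: "(real^'n) \<times> real \<Rightarrow> real"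
  proof -
    let ?w = "weak_gradient ?H \<omega>"
    have \<omega>_hom: "\<omega> \<in> hom_sobolev ?H p" and \<omega>_trace: "has_trace p \<omega> t"
      using \<omega> unfolding admissible_def t_eq by auto
    have w_Lp: "?w \<in> Lp_space ?H p"
      by (rule hom_sobolev_weak_gradient(2)[OF open_halfspace \<omega>_hom])
    have iw: "integrable (lebesgue_on ?H) (\<lambda>z. norm (?w z) powr p)"
      using w_Lp by (simp add: Lp_space_def)
    have G_Lp: "G \<in> Lp_space ?H (p / (p - 1))"
      and flux: "(LINT z|lebesgue_on ?H. weak_gradient ?H f z \<bullet> G z) = (LINT z|lebesgue_on ?H. ?w z \<bullet> G z)"
      using flux_determined_by_trace[OF p f_hom f_trace \<omega>_hom \<omega>_trace ct]
      unfolding G_def[abs_def] e_def N_def by simp_all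
    have iwG: "integrable (lebesgue_on ?H) (\<lambda>z. ?w z \<bullet> G z)"
      by (rule Hoelder_inner(1)[OF p(1) conjugate_exponent[OF p(1)] w_Lp G_Lp])
    \<comment> \<open>The proportionality constant between |F|^(p-1) and |G|.\<close>
    define l where "l = a powr (p - 1)"
    have l: "l > 0" using a by (simp add: l_def)
    have lG: "l * norm (G z) = norm (F z) powr (p - 1)" if "z \<in> ?H" for z
    proof -
      have "(a * r powr (- b)) powr (p - 1) = a powr (p - 1) * r powr (- (b * (p - 1)))" for b r
        using a by (simp add: powr_mult powr_powr)
      from this[of "norm (z + e)" "2 * \<beta> + 1"] show ?thesis
        unfolding \<beta>1 normF[OF that] normG[OF that] l_def by simp
    qed
    \<comment> \<open>\<open>F\<close> points towards - e and \<open>G\<close> away from it, so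
      Cauchy-Schwarz is an equality with a minus sign; this accounts for the factor
      \<open>- l\<close>.\<close>
    have FG: "norm (F z) powr p = - l * (F z \<bullet> G z)" if z: "z \<in> ?H" for z
    proof -
      have "F z \<bullet> G z = - (norm (F z) * norm (G z))"
        using a Hn[OF z] by (simp add: F_def G_def abs_mult dot_square_norm power2_eq_square)
      then have "- l * (F z \<bullet> G z) = norm (F z) * (l * norm (G z))" by simp
      also have "\<dots> = norm (F z) powr 1 * norm (F z) powr (p - 1)"
        unfolding lG[OF z] by simp
      also have "\<dots> = norm (F z) powr p" unfolding powr_add[symmetric] by simp
      finally show ?thesis by simp
    qed
    have "energy p f = (LINT z|lebesgue_on ?H. - l * (F z \<bullet> G z))"
      unfolding energy_f using FG by (intro Bochner_Integration.integral_cong) (auto simp: space_restrict_space)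
    also have "\<dots> = - l * (LINT z|lebesgue_on ?H. F z \<bullet> G z)" by simp
    also have "(LINT z|lebesgue_on ?H. F z \<bullet> G z) = (LINT z|lebesgue_on ?H. weak_gradient ?H f z \<bullet> G z)"
      using wgf Fm gfm Gm by (intro integral_cong_AE) (auto elim!: AE_mp)
    also have "- l * (LINT z|lebesgue_on ?H. weak_gradient ?H f z \<bullet> G z) =
        (LINT z|lebesgue_on ?H. - l * (?w z \<bullet> G z))"
      unfolding flux by simp
    also have "\<dots> \<le> (LINT z|lebesgue_on ?H. (p - 1) / p * norm (F z) powr p + norm (?w z) powr p / p)"
    proof (rule integral_mono)
      show "integrable (lebesgue_on ?H) (\<lambda>z. - l * (?w z \<bullet> G z))"
        by (intro integrable_mult_right iwG)
      show "integrable (lebesgue_on ?H) (\<lambda>z. (p - 1) / p * norm (F z) powr p + norm (?w z) powr p / p)"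
        by (intro Bochner_Integration.integrable_add integrable_mult_right iF integrable_divide iw)
      fix z assume "z \<in> space (lebesgue_on ?H)"
      then have z: "z \<in> ?H" by (simp add: space_restrict_space)
      \<comment> \<open>Cauchy-Schwarz and then Young's inequality for |w| and |F|^(p-1) with
        exponents p and p / (p - 1); both are equalities at w = F.\<close>
      have "- l * (?w z \<bullet> G z) \<le> l * (norm (?w z) * norm (G z))"
        using Cauchy_Schwarz_ineq2[of "?w z" "G z"] l mult_left_mono[of "- (?w z \<bullet> G z)" "norm (?w z) * norm (G z)" l]
        by simp
      also have "\<dots> = norm (?w z) * norm (F z) powr (p - 1)"
        unfolding lG[OF z, symmetric] by simp
      also have "\<dots> \<le> norm (?w z) powr p / p + (norm (F z) powr (p - 1)) powr (p / (p - 1)) / (p / (p - 1))"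
        by (rule Youngs_inequality[OF p(1) conjugate_exponent[OF p(1)]]) auto
      also have "\<dots> = (p - 1) / p * norm (F z) powr p + norm (?w z) powr p / p"
        using p by (simp add: powr_powr)
      finally show "- l * (?w z \<bullet> G z) \<le> (p - 1) / p * norm (F z) powr p + norm (?w z) powr p / p" .
    qed
    also have "\<dots> = (p - 1) / p * energy p f + energy p \<omega> / p"
      unfolding energy_f using iF iw by (simp add: energy_def)
    \<comment> \<open>Moving (p - 1) / p of the energy of \<open>f\<close> to the left leaves the
      weight 1 / p on both sides.\<close>
    finally show ?thesis using p(1) by (simp add: field_simps)
  qed
  with f_adm show ?thesis by blast
qed

end
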